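(* Let $G$ be a finite group, let $p$ be a prime, and let $P$ be a Sylow $p$-subgroup of $G$. Then $\Gamma_p(G)$ is disconnected if and only if $P$ has only one subgroup of order $p$ (that is, exactly one) or $G$ has a strongly $p$-embedded proper subgroup. Furthermore, if $P$ has a unique subgroup of order $p$, then $\Gamma_p(G)$ has exactly $p\,|G:N_G(\Omega_1(P))|$ connected components.
   Context: $\operatorname{Irr}(H)$ is the set of complex irreducible characters of $H$. $\Gamma_p(G)$ is the set of all pairs $(H,\varphi)$ with $H$ a non-trivial $p$-subgroup of $G$ and $\varphi\in\operatorname{Irr}(H)$, partially ordered by: $(H,\varphi)\le(K,\psi)$ if $H\le K$ and $[\varphi,\psi_H]\ne 0$, where $\psi_H$ is the restriction of $\psi$ to $H$ and $[\cdot,\cdot]$ is the inner product of characters. In a poset $X$, two elements lie in the same connected component if they can be joined by a finite sequence of elements of $X$ in which every two consecutive elements are comparable. $X$ is disconnected if it has more than one connected component. A proper subgroup $H$ of $G$ is strongly $p$-embedded in $G$ if $p$ divides $|H|$ and $p\nmid|H\cap H^x|$ for each $x\in G\setminus H$, where $H^x=x^{-1}Hx$. $\Omega_1(P)=\langle x\in P\mid x^p=1\rangle$. *)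

theory Defs
  imports Complex_Main "HOL-Algebra.Algebra" "Jordan_Normal_Form.VS_Connect"
begin

definition GL :: "nat \<Rightarrow> complex mat monoid" where
  "GL n = units_of (ring_mat TYPE(complex) n ())"

definition is_rep :: "('a, 'b) monoid_scheme \<Rightarrow> nat \<Rightarrow> ('a \<Rightarrow> complex mat) \<Rightarrow> bool" where
  "is_rep G n \<rho> \<longleftrightarrow> \<rho> \<in> hom G (GL n)"

definition irreducible_rep :: "('a, 'b) monoid_scheme \<Rightarrow> nat \<Rightarrow> ('a \<Rightarrow> complex mat) \<Rightarrow> bool" where
  "irreducible_rep G n \<rho> \<longleftrightarrow> is_rep G n \<rho> \<and> n > 0 \<and>
     (\<forall>W. VectorSpace.subspace class_ring W (module_vec TYPE(complex) n) \<longrightarrow>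
          (\<forall>g\<in>carrier G. \<forall>w\<in>W. \<rho> g *\<^sub>v w \<in> W) \<longrightarrow>
          W = {0\<^sub>v n} \<or> W = carrier_vec n)"

definition mat_trace :: "complex mat \<Rightarrow> complex" where
  "mat_trace A = (\<Sum>i<dim_row A. A $$ (i, i))"

text \<open>Class functions on a group are functions that are \<open>undefined\<close> outside its carrier, so
  that equality of HOL functions is equality of characters, and \<open>restrict\<close> is restriction.\<close>

definition character_of :: "('a, 'b) monoid_scheme \<Rightarrow> ('a \<Rightarrow> complex mat) \<Rightarrow> 'a \<Rightarrow> complex" where
  "character_of G \<rho> = (\<lambda>g\<in>carrier G. mat_trace (\<rho> g))"

definition Irr :: "('a, 'b) monoid_scheme \<Rightarrow> ('a \<Rightarrow> complex) set" where
  "Irr G = {character_of G \<rho> | n \<rho>. irreducible_rep G n \<rho>}"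

definition char_inner :: "('a, 'b) monoid_scheme \<Rightarrow> ('a \<Rightarrow> complex) \<Rightarrow> ('a \<Rightarrow> complex) \<Rightarrow> complex" where
  "char_inner G \<phi> \<psi> = (\<Sum>g\<in>carrier G. \<phi> g * cnj (\<psi> g)) / of_nat (Coset.order G)"

definition p_subgroup :: "('a, 'b) monoid_scheme \<Rightarrow> nat \<Rightarrow> 'a set \<Rightarrow> bool" where
  "p_subgroup G p H \<longleftrightarrow> subgroup H G \<and> (\<exists>k. card H = p ^ k)"

definition sylow_subgroup :: "('a, 'b) monoid_scheme \<Rightarrow> nat \<Rightarrow> 'a set \<Rightarrow> bool" where
  "sylow_subgroup G p P \<longleftrightarrow> subgroup P G \<and> card P = p ^ multiplicity p (Coset.order G)"

definition strongly_embedded :: "('a, 'b) monoid_scheme \<Rightarrow> nat \<Rightarrow> 'a set \<Rightarrow> bool" where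
  "strongly_embedded G p H \<longleftrightarrow> subgroup H G \<and> H \<noteq> carrier G \<and> p dvd card H \<and>
     (\<forall>x\<in>carrier G - H. \<not> p dvd card (H \<inter> (inv\<^bsub>G\<^esub> x <#\<^bsub>G\<^esub> H #>\<^bsub>G\<^esub> x)))"

definition Omega1 :: "('a, 'b) monoid_scheme \<Rightarrow> nat \<Rightarrow> 'a set \<Rightarrow> 'a set" where
  "Omega1 G p P = generate G {x \<in> P. x [^]\<^bsub>G\<^esub> p = \<one>\<^bsub>G\<^esub>}"

definition Gamma :: "('a, 'b) monoid_scheme \<Rightarrow> nat \<Rightarrow> ('a set \<times> ('a \<Rightarrow> complex)) set" where
  "Gamma G p = {(H, \<phi>). p_subgroup G p H \<and> H \<noteq> {\<one>\<^bsub>G\<^esub>} \<and> \<phi> \<in> Irr (G\<lparr>carrier := H\<rparr>)}"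

definition Gamma_le :: "('a, 'b) monoid_scheme \<Rightarrow>
    'a set \<times> ('a \<Rightarrow> complex) \<Rightarrow> 'a set \<times> ('a \<Rightarrow> complex) \<Rightarrow> bool" where
  "Gamma_le G = (\<lambda>(H, \<phi>) (K, \<psi>).
     H \<subseteq> K \<and> char_inner (G\<lparr>carrier := H\<rparr>) \<phi> (restrict \<psi> H) \<noteq> 0)"

definition poset_components :: "'x set \<Rightarrow> ('x \<Rightarrow> 'x \<Rightarrow> bool) \<Rightarrow> 'x set set" where
  "poset_components S r =
     S // {(x, y). x \<in> S \<and> y \<in> S \<and> equivclp (\<lambda>a b. a \<in> S \<and> b \<in> S \<and> r a b) x y}"

definition poset_disconnected :: "'x set \<Rightarrow> ('x \<Rightarrow> 'x \<Rightarrow> bool) \<Rightarrow> bool" where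
  "poset_disconnected S r \<longleftrightarrow>
     (\<exists>C\<in>poset_components S r. \<exists>D\<in>poset_components S r. C \<noteq> D)"

end

theory Submission
  imports Defs "HOL-Number_Theory.Cong" "Jordan_Normal_Form.Spectral_Radius"
begin

text \<open>
  If $P$ has a unique subgroup of order $p$, then every non-trivial $p$-subgroup $H$ has a unique
  subgroup $Z$ of order $p$, and $Z$ is central in $H$. By Schur's lemma, $\varphi \in \mathrm{Irr}(H)$
  restricts to $\varphi(1)\lambda$ on $Z$ with $\lambda$ linear. The pair $(Z, \lambda)$ lies below
  $(H, \varphi)$ and is the same for comparable pairs, so it labels the components. There are $p$
  choices of $\lambda$ for each of the $|G : N_G(\Omega_1(P))|$ conjugates of $\Omega_1(P)$.

  Projection onto the first component is order preserving, so the strongly embedded case reduces to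
  the poset of non-trivial $p$-subgroups, where a strongly embedded $M$ separates the subgroups
  inside $M$ from the others. If no such $M$ exists, this poset is connected, because the stabiliser
  of the component of $P$ would be strongly embedded if it were proper.

  If $P$ has two subgroups of order $p$, every $(H, \varphi)$ is connected to some $(B, 1_B)$:
  choose $A \le H$ of order $p$ and a linear constituent $\chi$ of $\varphi_A$, choose $B \ne A$ of
  order $p$ centralising $A$, and extend $\chi$ to $A \times B$ trivially on $B$.
\<close>

section \<open>Actions of finite \<open>p\<close>-groups\<close>

text \<open>A general irreducible character enters only through two facts: its value at the identity
  is non-zero, and a central element acts by a scalar. The rest works with linear characters, and
  inner products matter only through being non-zero. The label is constant on comparable pairs
  because the substitution h -> hz, with z in Z, multiplies the sum of phi times conjugate psi by
  lambda(z) times the conjugate of mu(z), where lambda and mu are the labels of phi and psi. A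
  non-zero sum forces this factor to be 1, and mu(z) is a root of unity, so the labels agree. In the
  connected case the obstacle is to forget the character. The second, commuting subgroup B serves
  for this: the extended character is trivial on it. The trivial characters are the right target
  because H -> (H, 1_H) is order preserving, so it carries chains of p-subgroups to chains of pairs,
  and what remains is a question about subgroups alone.\<close>

lemma group_actionI:
  assumes "group G"
    and closed: "\<And>g x. g \<in> carrier G \<Longrightarrow> x \<in> E \<Longrightarrow> \<phi> g x \<in> E"
    and one: "\<And>x. x \<in> E \<Longrightarrow> \<phi> \<one>\<^bsub>G\<^esub> x = x"
    and mult: "\<And>g h x. g \<in> carrier G \<Longrightarrow> h \<in> carrier G \<Longrightarrow> x \<in> E \<Longrightarrow> \<phi> (g \<otimes>\<^bsub>G\<^esub> h) x = \<phi> g (\<phi> h x)"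
  shows "group_action G E (\<lambda>g. restrict (\<phi> g) E)"
proof -
  interpret group G by fact
  have bij: "bij_betw (\<phi> g) E E" if g: "g \<in> carrier G" for g
  proof (rule bij_betw_byWitness[where f' = "\<phi> (inv\<^bsub>G\<^esub> g)"])
    show "\<forall>x\<in>E. \<phi> (inv\<^bsub>G\<^esub> g) (\<phi> g x) = x" "\<forall>x\<in>E. \<phi> g (\<phi> (inv\<^bsub>G\<^esub> g) x) = x"
      using g mult[of "inv\<^bsub>G\<^esub> g" g] mult[of g "inv\<^bsub>G\<^esub> g"] one by auto
  qed (use g closed in auto)
  then have Bij: "restrict (\<phi> g) E \<in> Bij E" if "g \<in> carrier G" for g
    using that by (simp add: Bij_def cong: bij_betw_cong)
  have "(\<lambda>g. restrict (\<phi> g) E) \<in> hom G (BijGroup E)"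
  proof (rule homI)
    fix g h assume "g \<in> carrier G" "h \<in> carrier G"
    then show "restrict (\<phi> (g \<otimes>\<^bsub>G\<^esub> h)) E = restrict (\<phi> g) E \<otimes>\<^bsub>BijGroup E\<^esub> restrict (\<phi> h) E"
      using Bij closed mult by (auto simp: BijGroup_def compose_def restrict_def)
  qed (use Bij in \<open>simp add: BijGroup_def\<close>)
  then show ?thesis
    by (simp add: group_action_def group_hom_def group_hom_axioms_def group_BijGroup assms(1))
qed

text \<open>Orbit sizes divide \<open>p ^ k\<close>, so every orbit that is not a single point
  contributes a multiple of \<open>p\<close>. Applied to conjugation this yields a non-trivial
  centre; applied to cosets it places \<open>p\<close>-subgroups inside Sylow conjugates.\<close>

lemma (in group_action) card_fixed_points_cong:
  assumes "finite E" and p: "Factorial_Ring.prime (p::nat)" and ord: "Coset.order G = p ^ k"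
  shows "[card {x \<in> E. \<forall>g\<in>carrier G. \<phi> g x = x} = card E] (mod p)"
proof -
  let ?O = "orbits G E \<phi>"
  define F where "F = {x \<in> E. \<forall>g\<in>carrier G. \<phi> g x = x}"
  interpret group G using group_hom group_hom.axioms(1) by auto
  have finO: "finite ?O" unfolding orbits_def using assms(1) by simp
  have sub: "orb \<subseteq> E" if "orb \<in> ?O" for orb using orbits_coverture that by auto
  have fixed_orbit: "orbit G \<phi> x = {x}" if "x \<in> F" for x
    using that one_closed unfolding F_def orbit_def by force
  have F: "(\<lambda>x. {x}) ` F = {orb \<in> ?O. card orb = 1}"
  proof
    show "(\<lambda>x. {x}) ` F \<subseteq> {orb \<in> ?O. card orb = 1}"
      using fixed_orbit unfolding orbits_def F_def by fastforce
    show "{orb \<in> ?O. card orb = 1} \<subseteq> (\<lambda>x. {x}) ` F"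
    proof
      fix orb assume "orb \<in> {orb \<in> ?O. card orb = 1}"
      then obtain x y where x: "x \<in> E" "orb = orbit G \<phi> x" and y: "orb = {y}"
        by (auto simp: orbits_def card_1_singleton_iff)
      then have orb: "orb = {x}" using orbit_refl[OF x(1)] by (metis singletonD)
      then have "x \<in> F" using x unfolding F_def orbit_def by auto
      then show "orb \<in> (\<lambda>x. {x}) ` F" using orb by auto
    qed
  qed
  have dvd: "p dvd card orb" if "orb \<in> ?O" "card orb \<noteq> 1" for orb
  proof -
    obtain x where x: "x \<in> E" "orb = orbit G \<phi> x" using \<open>orb \<in> ?O\<close> by (auto simp: orbits_def)
    then have "card orb dvd p ^ k" using orbit_stabilizer_theorem[OF x(1)] ord
      by (metis dvd_triv_left)
    then obtain i where i: "card orb = p ^ i" using p divides_primepow_nat by blast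
    then show ?thesis using that(2) by (cases i) auto
  qed
  have "card E = (\<Sum>orb\<in>?O. card orb)"
    using disjoint_sum[OF assms(1), of "\<lambda>_. 1::nat"] by simp
  also have "\<dots> = (\<Sum>orb | orb \<in> ?O \<and> card orb = 1. card orb) + (\<Sum>orb | orb \<in> ?O \<and> card orb \<noteq> 1. card orb)"
    using finO by (subst sum.union_disjoint[symmetric]) (auto intro!: sum.cong)
  also have "(\<Sum>orb | orb \<in> ?O \<and> card orb = 1. card orb) = card ((\<lambda>x. {x}) ` F)"
    by (simp add: F)
  also have "\<dots> = card F" by (rule card_image) auto
  finally have "card E = card F + (\<Sum>orb | orb \<in> ?O \<and> card orb \<noteq> 1. card orb)" .
  moreover have "p dvd (\<Sum>orb | orb \<in> ?O \<and> card orb \<noteq> 1. card orb)"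
    using dvd by (intro dvd_sum) auto
  ultimately have "[card F = card E] (mod p)"
    by (auto simp: cong_def elim!: dvdE)
  then show ?thesis by (simp add: F_def)
qed

text \<open>With exponent 1 and an arbitrary cofactor \<open>m\<close>, \<open>sylow_thm\<close> is
  Cauchy's theorem.\<close>

lemma (in group) cauchy_subgroup:
  assumes "Factorial_Ring.prime (p::nat)" "finite (carrier G)" "subgroup H G" "p dvd card H"
  obtains Q where "subgroup Q G" "Q \<subseteq> H" "card Q = p"
proof -
  interpret H: group "G\<lparr>carrier := H\<rparr>" using assms(3) by (rule subgroup_imp_group)
  have "finite H" using assms(2,3) subgroup.subset finite_subset by blast
  obtain m where "card H = p ^ 1 * m" using assms(4) by auto
  then have "\<exists>Q. subgroup Q (G\<lparr>carrier := H\<rparr>) \<and> card Q = p ^ 1"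
    using sylow_thm[OF assms(1) H.is_group, of 1 m] \<open>finite H\<close>
    by (auto simp: Coset.order_def)
  then obtain Q where "subgroup Q (G\<lparr>carrier := H\<rparr>)" "card Q = p" by auto
  then show thesis
    using that[of Q] incl_subgroup[OF assms(3)] subgroup.subset[of Q "G\<lparr>carrier := H\<rparr>"] by auto
qed

lemma (in group) p_group_central_subgroup:
  assumes p: "Factorial_Ring.prime (p::nat)" and fin: "finite (carrier G)" and card: "Coset.order G = p ^ k"
    and nontriv: "carrier G \<noteq> {\<one>}"
  obtains Z where "subgroup Z G" "card Z = p" "\<And>z g. z \<in> Z \<Longrightarrow> g \<in> carrier G \<Longrightarrow> z \<otimes> g = g \<otimes> z"
proof -
  define C where "C = {z \<in> carrier G. \<forall>g\<in>carrier G. z \<otimes> g = g \<otimes> z}"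
  have C: "subgroup C G"
  proof
    fix x assume x: "x \<in> C"
    then have xc: "x \<in> carrier G" by (simp add: C_def)
    show "x \<otimes> y \<in> C" if y: "y \<in> C" for y
    proof -
      have yc: "y \<in> carrier G" using y by (simp add: C_def)
      have "x \<otimes> y \<otimes> g = g \<otimes> (x \<otimes> y)" if g: "g \<in> carrier G" for g
      proof -
        have "x \<otimes> y \<otimes> g = x \<otimes> (g \<otimes> y)" using y g by (simp add: m_assoc[OF xc yc g] C_def)
        also have "\<dots> = (g \<otimes> x) \<otimes> y" using x g by (simp add: m_assoc[OF xc g yc, symmetric] C_def)
        finally show ?thesis by (simp add: m_assoc[OF g xc yc])
      qed
      then show ?thesis using xc yc by (simp add: C_def)
    qed
    show "inv x \<in> C"
    proof -
      have "inv x \<otimes> g = g \<otimes> inv x" if g: "g \<in> carrier G" for g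
      proof -
        have "inv x \<otimes> g \<otimes> x = inv x \<otimes> (x \<otimes> g)" using x g by (simp add: m_assoc C_def)
        also have "\<dots> = g" using xc g by (simp add: m_assoc[symmetric])
        finally have "inv x \<otimes> g \<otimes> x = g" .
        then show ?thesis using xc g by (metis inv_closed inv_solve_right m_closed)
      qed
      then show ?thesis using xc by (simp add: C_def)
    qed
  qed (auto simp: C_def)
  interpret act: group_action G "carrier G" "\<lambda>g. \<lambda>h\<in>carrier G. g \<otimes> h \<otimes> inv g"
    by (rule action_by_conjugation)
  \<comment> \<open>The centre is the fixed-point set of conjugation, so its order is congruent to
    \<open>p ^ k\<close> and hence divisible by \<open>p\<close>; Cauchy's theorem then applies
    inside the centre.\<close>
  have "C = {x \<in> carrier G. \<forall>g\<in>carrier G. (\<lambda>h\<in>carrier G. g \<otimes> h \<otimes> inv g) x = x}"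
    using inv_solve_right' by (force simp: C_def)
  then have "[card C = p ^ k] (mod p)"
    using act.card_fixed_points_cong[OF fin p card] card by (simp add: Coset.order_def)
  moreover have "k \<noteq> 0"
    using card nontriv one_closed
    by (metis Coset.order_def card_1_singletonE power_0 singletonD)
  ultimately have "p dvd card C" using cong_dvd_iff dvd_power by blast
  then obtain Z where "subgroup Z G" "Z \<subseteq> C" "card Z = p" by (rule cauchy_subgroup[OF p fin C])
  then show thesis using that[of Z] unfolding C_def by blast
qed

section \<open>Conjugates of Sylow subgroups\<close>

text \<open>This conjugates as g H g^-1, opposite to the H^x of \<open>strongly_embedded\<close>,
  which is therefore rendered as \<open>conj_set G (inv x) H\<close>. The form as an image makes
  monotonicity and cardinality immediate.\<close>

definition conj_set :: "('a, 'b) monoid_scheme \<Rightarrow> 'a \<Rightarrow> 'a set \<Rightarrow> 'a set" where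
  "conj_set G g H = (\<lambda>h. g \<otimes>\<^bsub>G\<^esub> h \<otimes>\<^bsub>G\<^esub> inv\<^bsub>G\<^esub> g) ` H"

lemma conj_set_eq_cosets: "g <#\<^bsub>G\<^esub> H #>\<^bsub>G\<^esub> inv\<^bsub>G\<^esub> g = conj_set G g H"
  by (auto simp: r_coset_def l_coset_def conj_set_def)

lemma conj_set_mono: "H \<subseteq> K \<Longrightarrow> conj_set G g H \<subseteq> conj_set G g K"
  by (auto simp: conj_set_def)

context group
begin

lemma conj_set_mult:
  assumes "g \<in> carrier G" "h \<in> carrier G" "H \<subseteq> carrier G"
  shows "conj_set G (g \<otimes> h) H = conj_set G g (conj_set G h H)"
proof -
  have "g \<otimes> h \<otimes> x \<otimes> inv (g \<otimes> h) = g \<otimes> (h \<otimes> x \<otimes> inv h) \<otimes> inv g" if "x \<in> H" for x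
  proof -
    have "x \<in> carrier G" using that assms(3) by auto
    then show ?thesis using assms(1,2) by (simp add: m_assoc inv_mult_group)
  qed
  then show ?thesis by (auto simp: conj_set_def image_image)
qed

lemma conj_set_one: "H \<subseteq> carrier G \<Longrightarrow> conj_set G \<one> H = H"
proof -
  assume "H \<subseteq> carrier G"
  then have "(\<lambda>h. \<one> \<otimes> h \<otimes> inv \<one>) ` H = (\<lambda>h. h) ` H" by (intro image_cong) auto
  then show ?thesis by (simp add: conj_set_def)
qed

lemma conj_set_inv_cancel:
  assumes "g \<in> carrier G" "H \<subseteq> carrier G"
  shows "conj_set G (inv g) (conj_set G g H) = H" "conj_set G g (conj_set G (inv g) H) = H"
  using assms conj_set_mult[of "inv g" g H] conj_set_mult[of g "inv g" H] conj_set_one by auto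

lemma subgroup_conj_set: "g \<in> carrier G \<Longrightarrow> subgroup H G \<Longrightarrow> subgroup (conj_set G g H) G"
  using subgroup_conjugation_is_surj2 by (simp add: conj_set_eq_cosets)

lemma card_conj_set:
  assumes "g \<in> carrier G" "H \<subseteq> carrier G"
  shows "card (conj_set G g H) = card H"
  unfolding conj_set_def
proof (rule card_image, rule inj_onI)
  fix x y assume "x \<in> H" "y \<in> H" "g \<otimes> x \<otimes> inv g = g \<otimes> y \<otimes> inv g"
  then show "x = y" using assms by (intro conjugation_is_inj[of g x y]) auto
qed

lemma conj_set_trivial: "g \<in> carrier G \<Longrightarrow> conj_set G g {\<one>} = {\<one>}"
  by (simp add: conj_set_def)

lemma p_subgroup_conj_set: "g \<in> carrier G \<Longrightarrow> p_subgroup G p H \<Longrightarrow> p_subgroup G p (conj_set G g H)"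
  by (auto simp: p_subgroup_def subgroup_conj_set card_conj_set subgroup.subset)

lemma conj_set_centralised:
  assumes "z \<in> carrier G" "H \<subseteq> carrier G" "\<And>h. h \<in> H \<Longrightarrow> z \<otimes> h = h \<otimes> z"
  shows "conj_set G z H = H"
proof -
  have "z \<otimes> h \<otimes> inv z = h" if "h \<in> H" for h
  proof -
    have h: "h \<in> carrier G" using that assms(2) by auto
    then have "z \<otimes> h \<otimes> inv z = h \<otimes> z \<otimes> inv z" using assms(3)[OF that] by simp
    then show ?thesis using h assms(1) by (simp add: m_assoc)
  qed
  then show ?thesis by (simp add: conj_set_def)
qed

lemma conj_set_self:
  assumes "subgroup H G" "h \<in> H"
  shows "conj_set G h H = H"
proof -
  have sub: "conj_set G k H \<subseteq> H" if "k \<in> H" for k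
    using assms(1) that by (auto simp: conj_set_def subgroup.m_closed subgroup.m_inv_closed)
  have "H \<subseteq> carrier G" "h \<in> carrier G" using assms subgroup.subset by auto
  then have "H = conj_set G h (conj_set G (inv h) H)" by (simp add: conj_set_inv_cancel)
  also have "\<dots> \<subseteq> conj_set G h H"
    using sub[OF subgroup.m_inv_closed[OF assms]] by (rule conj_set_mono)
  finally show ?thesis using sub[OF assms(2)] by auto
qed

lemma card_subgroup_dvd:
  assumes "finite (carrier G)" "subgroup A G" "subgroup B G" "A \<subseteq> B"
  shows "card A dvd card B"
proof -
  interpret B: group "G\<lparr>carrier := B\<rparr>" using assms(3) by (rule subgroup_imp_group)
  have "subgroup A (G\<lparr>carrier := B\<rparr>)" using assms subgroup_incl by blast
  then have "card A dvd Coset.order (G\<lparr>carrier := B\<rparr>)" by (metis B.lagrange dvd_triv_right)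
  then show ?thesis by (simp add: Coset.order_def)
qed

text \<open>\<open>Q\<close> acts on the cosets of \<open>P\<close>, whose number is prime to
  \<open>p\<close>, so some coset P x is fixed; then P x q = P x for all q in \<open>Q\<close>,
  which says x Q x^-1 lies in \<open>P\<close>. The hypothesis is on the index instead of
  \<open>sylow_subgroup\<close>, so that the lemma can be applied inside a subgroup \<open>M\<close>
  as well.\<close>

lemma p_subgroup_subset_conj:
  assumes p: "Factorial_Ring.prime (p::nat)" and fin: "finite (carrier G)"
    and P: "subgroup P G" "\<not> p dvd card (rcosets P)" and Q: "p_subgroup G p Q"
  obtains g where "g \<in> carrier G" "Q \<subseteq> conj_set G g P"
proof -
  have Qsub: "subgroup Q G" and "\<exists>k. card Q = p ^ k" using Q by (auto simp: p_subgroup_def)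
  then obtain k where k: "card Q = p ^ k" by auto
  interpret Q: group "G\<lparr>carrier := Q\<rparr>" using Qsub by (rule subgroup_imp_group)
  have Pc: "P \<subseteq> carrier G" and Qc: "Q \<subseteq> carrier G" using P(1) Qsub subgroup.subset by auto
  \<comment> \<open>Right translation reverses products; the inverse turns it into a left
    action.\<close>
  let ?act = "\<lambda>q R. R #> inv q"
  have "group_action (G\<lparr>carrier := Q\<rparr>) (rcosets P) (\<lambda>q. restrict (?act q) (rcosets P))"
  proof (rule group_actionI)
    fix q R assume "q \<in> carrier (G\<lparr>carrier := Q\<rparr>)" "R \<in> rcosets P"
    then show "R #> inv q \<in> rcosets P"
      using Pc Qc by (auto simp: RCOSETS_def coset_mult_assoc subset_iff)
  next
    fix R assume "R \<in> rcosets P"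
    then show "R #> inv \<one>\<^bsub>G\<lparr>carrier := Q\<rparr>\<^esub> = R"
      using Pc by (auto simp: RCOSETS_def coset_mult_assoc)
  next
    fix q r R assume "q \<in> carrier (G\<lparr>carrier := Q\<rparr>)" "r \<in> carrier (G\<lparr>carrier := Q\<rparr>)" "R \<in> rcosets P"
    then show "R #> inv (q \<otimes>\<^bsub>G\<lparr>carrier := Q\<rparr>\<^esub> r) = R #> inv r #> inv q"
      using Pc Qc by (auto simp: RCOSETS_def coset_mult_assoc subset_iff inv_mult_group m_assoc)
  qed (rule Q.is_group)
  then interpret act: group_action "G\<lparr>carrier := Q\<rparr>" "rcosets P" "\<lambda>q. restrict (?act q) (rcosets P)" .
  have finR: "finite (rcosets P)" using fin by (simp add: RCOSETS_def)
  let ?F = "{R \<in> rcosets P. \<forall>q\<in>carrier (G\<lparr>carrier := Q\<rparr>). restrict (?act q) (rcosets P) R = R}"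
  have "[card ?F = card (rcosets P)] (mod p)"
    by (rule act.card_fixed_points_cong[OF finR p]) (use k in \<open>simp add: Coset.order_def\<close>)
  then have "\<not> p dvd card ?F" using P(2) cong_dvd_iff by blast
  then have "?F \<noteq> {}" by (metis card.empty dvd_0_right)
  then obtain R where R: "R \<in> rcosets P" and RQ: "\<forall>q\<in>Q. R #> inv q = R" by auto
  obtain x where x: "x \<in> carrier G" and Rx: "R = P #> x" using R by (auto simp: RCOSETS_def)
  have "\<forall>q\<in>Q. P #> x #> inv q = P #> x" using RQ by (simp add: Rx)
  with x have fixed: "P #> (x \<otimes> inv q) = P #> x" if "q \<in> Q" for q
    using that Qc \<open>\<forall>q\<in>Q. P #> x #> inv q = P #> x\<close> coset_mult_assoc[OF Pc x, of "inv q"]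
    by (metis inv_closed subsetD)
  have "conj_set G x Q \<subseteq> P"
  proof -
    have "x \<otimes> q \<otimes> inv x \<in> P" if q: "q \<in> Q" for q
    proof -
      have qc: "q \<in> carrier G" and q': "inv q \<in> Q" using q Qc Qsub subgroup.m_inv_closed by auto
      then have "x \<otimes> q \<in> P #> x"
        using repr_independenceD[OF P(1), of "x \<otimes> q" x] fixed[OF q'] x by auto
      then obtain a where "a \<in> P" "x \<otimes> q = a \<otimes> x" by (auto simp: r_coset_def)
      moreover then have "x \<otimes> q \<otimes> inv x = a" using x Pc by (auto simp: m_assoc)
      ultimately show ?thesis by simp
    qed
    then show ?thesis by (auto simp: conj_set_def)
  qed
  then have "conj_set G (inv x) (conj_set G x Q) \<subseteq> conj_set G (inv x) P" by (rule conj_set_mono)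
  then show thesis using that[of "inv x"] x Qc by (simp add: conj_set_inv_cancel)
qed

lemma sylow_not_dvd_index:
  assumes "Factorial_Ring.prime (p::nat)" "finite (carrier G)" "sylow_subgroup G p P"
  shows "\<not> p dvd card (rcosets P)"
proof
  assume "p dvd card (rcosets P)"
  then obtain m where m: "card (rcosets P) = p * m" by (rule dvdE)
  have "Coset.order G = p * m * p ^ multiplicity p (Coset.order G)"
    using lagrange[of P] assms(3) m by (simp add: sylow_subgroup_def)
  then have "Coset.order G = p ^ Suc (multiplicity p (Coset.order G)) * m"
    by (simp add: mult.commute mult.left_commute)
  then have "p ^ Suc (multiplicity p (Coset.order G)) dvd Coset.order G" by (rule dvdI)
  moreover have "Coset.order G \<noteq> 0" using assms(2) order_gt_0_iff_finite by auto
  moreover have "\<not> is_unit p" using assms(1) not_prime_unit by blast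
  ultimately show False
    using power_dvd_iff_le_multiplicity[of "Coset.order G" p "Suc (multiplicity p (Coset.order G))"]
    by linarith
qed

lemma p_subgroup_central:
  assumes p: "Factorial_Ring.prime (p::nat)" and fin: "finite (carrier G)"
    and H: "p_subgroup G p H" "H \<noteq> {\<one>}"
  obtains Z where "subgroup Z G" "Z \<subseteq> H" "card Z = p" "\<And>z h. z \<in> Z \<Longrightarrow> h \<in> H \<Longrightarrow> z \<otimes> h = h \<otimes> z"
proof -
  have Hsub: "subgroup H G" and "\<exists>k. card H = p ^ k" using H by (auto simp: p_subgroup_def)
  then obtain k where k: "card H = p ^ k" by auto
  interpret H: group "G\<lparr>carrier := H\<rparr>" using Hsub by (rule subgroup_imp_group)
  have "finite H" using fin Hsub subgroup.subset finite_subset by blast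
  then have "finite (carrier (G\<lparr>carrier := H\<rparr>))" "Coset.order (G\<lparr>carrier := H\<rparr>) = p ^ k"
    "carrier (G\<lparr>carrier := H\<rparr>) \<noteq> {\<one>\<^bsub>G\<lparr>carrier := H\<rparr>\<^esub>}"
    using k H(2) by (simp_all add: Coset.order_def)
  then obtain Z where Z: "subgroup Z (G\<lparr>carrier := H\<rparr>)" "card Z = p"
    and comm: "\<And>z g. z \<in> Z \<Longrightarrow> g \<in> carrier (G\<lparr>carrier := H\<rparr>) \<Longrightarrow>
      z \<otimes>\<^bsub>G\<lparr>carrier := H\<rparr>\<^esub> g = g \<otimes>\<^bsub>G\<lparr>carrier := H\<rparr>\<^esub> z"
    by (rule H.p_group_central_subgroup[OF p]) blast
  show thesis
  proof (rule that[of Z])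
    show "subgroup Z G" using Z(1) by (rule incl_subgroup[OF Hsub])
    show "Z \<subseteq> H" using subgroup.subset[OF Z(1)] by simp
    show "z \<otimes> h = h \<otimes> z" if "z \<in> Z" "h \<in> H" for z h using comm[of z h] that by simp
  qed (fact Z(2))
qed

lemma p_dvd_card_p_subgroup:
  assumes "p_subgroup G p H" "H \<noteq> {\<one>}"
  shows "p dvd card H"
proof -
  obtain k where k: "card H = p ^ k" and H: "subgroup H G" using assms by (auto simp: p_subgroup_def)
  have "k \<noteq> 0" using k assms(2) subgroup.one_closed[OF H] by (auto simp: card_1_singleton_iff)
  then show ?thesis using k by (simp add: dvd_power)
qed

end

section \<open>Components of posets and strongly embedded subgroups\<close>

text \<open>Every point is related to itself, also outside \<open>S\<close>, so chains can be
  composed and mapped without membership conditions; \<open>poset_components_eq\<close> puts these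
  back.\<close>

definition poset_conn :: "'x set \<Rightarrow> ('x \<Rightarrow> 'x \<Rightarrow> bool) \<Rightarrow> 'x \<Rightarrow> 'x \<Rightarrow> bool" where
  "poset_conn S r = equivclp (\<lambda>a b. a \<in> S \<and> b \<in> S \<and> r a b)"

lemma poset_conn_refl [simp]: "poset_conn S r x x"
  by (simp add: poset_conn_def equivclp_def)

lemma poset_conn_sym: "poset_conn S r x y \<Longrightarrow> poset_conn S r y x"
  unfolding poset_conn_def by (rule equivclp_sym)

lemma poset_conn_trans: "poset_conn S r x y \<Longrightarrow> poset_conn S r y z \<Longrightarrow> poset_conn S r x z"
  unfolding poset_conn_def by (rule transpD[OF transp_equivclp])

lemma poset_conn_step: "r x y \<Longrightarrow> x \<in> S \<Longrightarrow> y \<in> S \<Longrightarrow> poset_conn S r x y"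
  unfolding poset_conn_def equivclp_def by (rule r_into_rtranclp) (simp add: symclp_def)

text \<open>A single comparison may go to a whole chain. The maps used later are conjugation by
  \<open>g\<close>, the projection of \<open>Gamma\<close> to subgroups, and H -> (H, 1_H).\<close>

lemma poset_conn_map:
  assumes "\<And>a b. a \<in> S \<Longrightarrow> b \<in> S \<Longrightarrow> r a b \<Longrightarrow> poset_conn S' r' (f a) (f b)"
    and "poset_conn S r x y"
  shows "poset_conn S' r' (f x) (f y)"
  using assms(2) unfolding poset_conn_def[of S]
proof (induction rule: equivclp_induct)
  case (step y z)
  from step(2) have "poset_conn S' r' (f y) (f z)"
    by (elim disjE conjE) (auto intro: assms(1) poset_conn_sym[OF assms(1)])
  with step.IH show ?case by (rule poset_conn_trans)
qed simp

lemma poset_conn_invariant: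
  assumes "\<And>a b. a \<in> S \<Longrightarrow> b \<in> S \<Longrightarrow> r a b \<Longrightarrow> f a = f b" and "poset_conn S r x y"
  shows "f x = f y"
  using assms(2) unfolding poset_conn_def
proof (induction rule: equivclp_induct)
  case (step y z)
  from step(2) have "f y = f z" by (elim disjE conjE) (auto dest: assms(1))
  with step.IH show ?case by simp
qed simp

lemma poset_components_eq:
  "poset_components S r = S // {(x, y). x \<in> S \<and> y \<in> S \<and> poset_conn S r x y}"
  by (simp add: poset_components_def poset_conn_def)

lemma equiv_poset_conn: "equiv S {(x, y). x \<in> S \<and> y \<in> S \<and> poset_conn S r x y}"
  by (intro equivI refl_onI symI transI) (auto intro: poset_conn_sym poset_conn_trans)

lemma poset_disconnected_iff:
  "poset_disconnected S r \<longleftrightarrow> (\<exists>x\<in>S. \<exists>y\<in>S. \<not> poset_conn S r x y)"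
proof -
  define E where "E = {(x, y). x \<in> S \<and> y \<in> S \<and> poset_conn S r x y}"
  have eq: "E `` {x} = E `` {y} \<longleftrightarrow> poset_conn S r x y" if "x \<in> S" "y \<in> S" for x y
    unfolding E_def using eq_equiv_class_iff[OF equiv_poset_conn that, of r] that by simp
  have "poset_disconnected S r \<longleftrightarrow> (\<exists>C\<in>S // E. \<exists>D\<in>S // E. C \<noteq> D)"
    by (simp add: poset_disconnected_def poset_components_eq E_def)
  also have "\<dots> \<longleftrightarrow> (\<exists>x\<in>S. \<exists>y\<in>S. E `` {x} \<noteq> E `` {y})" by (simp add: quotient_def)
  also have "\<dots> \<longleftrightarrow> (\<exists>x\<in>S. \<exists>y\<in>S. \<not> poset_conn S r x y)" by (simp add: eq)
  finally show ?thesis .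
qed

text \<open>\<open>L\<close> meets every component exactly once: each \<open>x\<close> is joined to
  \<open>f x\<close>, and since \<open>f\<close> is constant along chains and fixes
  \<open>L\<close>, two connected points of \<open>L\<close> coincide.\<close>

lemma card_poset_components_retract:
  assumes L: "L \<subseteq> S" and f: "\<And>x. x \<in> S \<Longrightarrow> f x \<in> L" "\<And>x. x \<in> L \<Longrightarrow> f x = x"
    and const: "\<And>x y. x \<in> S \<Longrightarrow> y \<in> S \<Longrightarrow> r x y \<Longrightarrow> f x = f y"
    and conn: "\<And>x. x \<in> S \<Longrightarrow> r (f x) x"
  shows "card (poset_components S r) = card L"
proof -
  define E where "E = {(x, y). x \<in> S \<and> y \<in> S \<and> poset_conn S r x y}"
  have eq: "E `` {x} = E `` {y} \<longleftrightarrow> poset_conn S r x y" if "x \<in> S" "y \<in> S" for x y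
    unfolding E_def using eq_equiv_class_iff[OF equiv_poset_conn that, of r] that by simp
  have conn': "poset_conn S r (f x) x" if "x \<in> S" for x
    using poset_conn_step[of r, OF conn[OF that] _ that] f(1)[OF that] L by auto
  have "inj_on (\<lambda>x. E `` {x}) L"
  proof (rule inj_onI)
    fix x y assume xy: "x \<in> L" "y \<in> L" and "E `` {x} = E `` {y}"
    then have "poset_conn S r x y" using eq[of x y] L by auto
    then have "f x = f y" by (rule poset_conn_invariant[rotated]) (use const in auto)
    then show "x = y" using f(2) xy by simp
  qed
  moreover have "(\<lambda>x. E `` {x}) ` L = S // E"
  proof -
    have "(\<lambda>x. E `` {x}) ` S = (\<lambda>x. E `` {f x}) ` S"
      using eq conn' f(1) L by (intro image_cong) (auto simp: poset_conn_sym subset_iff)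
    also have "\<dots> = (\<lambda>x. E `` {x}) ` f ` S" by (simp add: image_image)
    also have "f ` S = L" using f L by force
    finally have "(\<lambda>x. E `` {x}) ` S = (\<lambda>x. E `` {x}) ` L" .
    moreover have "(\<lambda>x. E `` {x}) ` S = S // E" by (auto simp: quotient_def)
    ultimately show ?thesis by metis
  qed
  ultimately have "card (S // E) = card L" by (metis card_image)
  then show ?thesis by (simp add: poset_components_eq E_def)
qed

section \<open>Strongly embedded subgroups and connectedness of the poset of p-subgroups\<close>

definition nontrivial_p_subgroups :: "('a, 'b) monoid_scheme \<Rightarrow> nat \<Rightarrow> 'a set set" where
  "nontrivial_p_subgroups G p = {H. p_subgroup G p H \<and> H \<noteq> {\<one>\<^bsub>G\<^esub>}}"

context group
begin

lemma strongly_embedded_iff: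
  "strongly_embedded G p M \<longleftrightarrow> subgroup M G \<and> M \<noteq> carrier G \<and> p dvd card M \<and>
    (\<forall>x\<in>carrier G - M. \<not> p dvd card (M \<inter> conj_set G (inv x) M))"
proof -
  have eq: "conj_set G (inv x) M = inv x <# M #> x" if "x \<in> carrier G" for x
    using conj_set_eq_cosets[of G "inv x" M] that by simp
  show ?thesis unfolding strongly_embedded_def by (auto simp: eq)
qed

text \<open>If \<open>A\<close> and x A x^-1 both lie in \<open>M\<close>, then \<open>A\<close>
  lies in the intersection of \<open>M\<close> with x^-1 M x, whose order is thus divisible by
  \<open>p\<close>. In particular \<open>M\<close> contains every element that centralises
  \<open>A\<close>.\<close>

lemma strongly_embeddedD:
  assumes M: "strongly_embedded G p M" and fin: "finite (carrier G)"
    and A: "subgroup A G" "p dvd card A" "A \<subseteq> M" and x: "x \<in> carrier G" "conj_set G x A \<subseteq> M"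
  shows "x \<in> M"
proof (rule ccontr)
  assume "x \<notin> M"
  have sub: "subgroup M G" using M by (simp add: strongly_embedded_iff)
  have "A = conj_set G (inv x) (conj_set G x A)"
    using conj_set_inv_cancel x(1) subgroup.subset[OF A(1)] by simp
  also have "\<dots> \<subseteq> conj_set G (inv x) M" using x(2) by (rule conj_set_mono)
  finally have "A \<subseteq> M \<inter> conj_set G (inv x) M" using A(3) by auto
  moreover have "subgroup (M \<inter> conj_set G (inv x) M) G"
    using sub x(1) by (intro subgroups_Inter_pair subgroup_conj_set) auto
  ultimately have "card A dvd card (M \<inter> conj_set G (inv x) M)"
    using card_subgroup_dvd[OF fin A(1)] by blast
  then have "p dvd card (M \<inter> conj_set G (inv x) M)" using A(2) dvd_trans by blast
  then show False using M x(1) \<open>x \<notin> M\<close> by (simp add: strongly_embedded_iff)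
qed

text \<open>Two centraliser steps through a central subgroup \<open>Z\<close> of order
  \<open>p\<close> in \<open>R\<close>: \<open>Z\<close> centralises \<open>Q\<close>, hence lies in
  \<open>M\<close>; then all of \<open>R\<close> centralises \<open>Z\<close>, hence lies in
  \<open>M\<close>.\<close>

lemma strongly_embedded_absorbs:
  assumes p: "Factorial_Ring.prime (p::nat)" and fin: "finite (carrier G)"
    and M: "strongly_embedded G p M" and R: "p_subgroup G p R"
    and Q: "subgroup Q G" "p dvd card Q" "Q \<subseteq> R" "Q \<subseteq> M"
  shows "R \<subseteq> M"
proof -
  have Rc: "R \<subseteq> carrier G" and Qc: "Q \<subseteq> carrier G"
    using R subgroup.subset[OF Q(1)] subgroup.subset[of R G] by (simp_all add: p_subgroup_def)
  have "card Q \<noteq> 1" using Q(2) p by auto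
  then have "Q \<noteq> {\<one>}" by auto
  then have "R \<noteq> {\<one>}" using Q(3) subgroup.one_closed[OF Q(1)] by auto
  then obtain Z where Z: "subgroup Z G" "Z \<subseteq> R" "card Z = p"
    "\<And>z h. z \<in> Z \<Longrightarrow> h \<in> R \<Longrightarrow> z \<otimes> h = h \<otimes> z"
    using p_subgroup_central[OF p fin R] by metis
  have ZM: "Z \<subseteq> M"
  proof
    fix z assume z: "z \<in> Z"
    have "conj_set G z Q = Q"
      using z Z(2,4) Q(3) Qc Rc by (intro conj_set_centralised) auto
    then show "z \<in> M" using strongly_embeddedD[OF M fin Q(1,2,4)] Q(4) z Z(2) Rc by auto
  qed
  show ?thesis
  proof
    fix x assume x: "x \<in> R"
    have "conj_set G x Z = Z"
      using x Z(2) Rc by (intro conj_set_centralised) (auto simp: Z(4)[OF _ x])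
    then show "x \<in> M" using strongly_embeddedD[OF M fin Z(1) _ ZM] ZM Z(3) x Rc by auto
  qed
qed

lemma strongly_embedded_disconnected:
  assumes p: "Factorial_Ring.prime (p::nat)" and fin: "finite (carrier G)"
    and M: "strongly_embedded G p M"
  obtains H K where "H \<in> nontrivial_p_subgroups G p" "K \<in> nontrivial_p_subgroups G p"
    "\<not> poset_conn (nontrivial_p_subgroups G p) (\<subseteq>) H K"
proof -
  let ?S = "nontrivial_p_subgroups G p"
  have Msub: "subgroup M G" and "M \<noteq> carrier G" "p dvd card M"
    using M by (auto simp: strongly_embedded_iff)
  obtain Q where Q: "subgroup Q G" "Q \<subseteq> M" "card Q = p"
    using cauchy_subgroup[OF p fin Msub \<open>p dvd card M\<close>] by metis
  have Qc: "Q \<subseteq> carrier G" using Q(1) subgroup.subset by auto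
  have QS: "Q \<in> ?S"
    using Q p by (auto simp: nontrivial_p_subgroups_def p_subgroup_def intro: exI[of _ 1])
  obtain x where x: "x \<in> carrier G" "x \<notin> M"
    using \<open>M \<noteq> carrier G\<close> subgroup.subset[OF Msub] by auto
  have "card (conj_set G x Q) = p" using card_conj_set x(1) Qc Q(3) by simp
  then have KS: "conj_set G x Q \<in> ?S"
    using subgroup_conj_set[OF x(1) Q(1)] p
    by (auto simp: nontrivial_p_subgroups_def p_subgroup_def intro: exI[of _ 1])
  have "\<not> conj_set G x Q \<subseteq> M"
    using strongly_embeddedD[OF M fin Q(1) _ Q(2) x(1)] Q(3) x(2) by auto
  \<comment> \<open>The truth value of \<open>A \<subseteq> M\<close> is the invariant along chains:
    it passes down trivially and up by \<open>strongly_embedded_absorbs\<close>.\<close>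
  moreover have "(Q \<subseteq> M) = (conj_set G x Q \<subseteq> M)" if "poset_conn ?S (\<subseteq>) Q (conj_set G x Q)"
    using that
  proof (rule poset_conn_invariant[rotated])
    fix A B assume "A \<in> ?S" "B \<in> ?S" "A \<subseteq> B"
    then show "(A \<subseteq> M) = (B \<subseteq> M)"
      using strongly_embedded_absorbs[OF p fin M, of B A] p_dvd_card_p_subgroup
      by (auto simp: nontrivial_p_subgroups_def p_subgroup_def)
  qed
  ultimately show thesis using that[OF QS KS] Q(2) by blast
qed

lemma nontrivial_p_subgroupsD:
  assumes "H \<in> nontrivial_p_subgroups G p"
  shows "p_subgroup G p H" "subgroup H G" "H \<subseteq> carrier G" "H \<noteq> {\<one>}"
  using assms subgroup.subset[of H G] by (simp_all add: nontrivial_p_subgroups_def p_subgroup_def)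

lemma prime_order_nontrivial_p_subgroup:
  assumes "Factorial_Ring.prime (p::nat)" "subgroup A G" "card A = p"
  shows "A \<in> nontrivial_p_subgroups G p"
  using assms by (auto simp: nontrivial_p_subgroups_def p_subgroup_def intro: exI[of _ 1])

lemma conj_set_nontrivial_p_subgroup:
  assumes "g \<in> carrier G" "H \<in> nontrivial_p_subgroups G p"
  shows "conj_set G g H \<in> nontrivial_p_subgroups G p"
proof -
  note H = nontrivial_p_subgroupsD[OF assms(2)]
  have "conj_set G g H \<noteq> {\<one>}"
    using conj_set_inv_cancel(1)[OF assms(1) H(3)] conj_set_trivial[of "inv g"] assms(1) H(4) by auto
  then show ?thesis
    using p_subgroup_conj_set[OF assms(1) H(1)] by (simp add: nontrivial_p_subgroups_def)
qed

lemma poset_conn_conj_set: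
  assumes "g \<in> carrier G" "poset_conn (nontrivial_p_subgroups G p) (\<subseteq>) H K"
  shows "poset_conn (nontrivial_p_subgroups G p) (\<subseteq>) (conj_set G g H) (conj_set G g K)"
  using assms(2)
  by (rule poset_conn_map[rotated])
    (intro poset_conn_step conj_set_mono conj_set_nontrivial_p_subgroup assms(1))

text \<open>The conjugating element has to lie in \<open>M\<close>, which will be the stabiliser of
  a component. \<open>P\<close> is also Sylow in \<open>M\<close>: if \<open>p\<close> divided its
  index there, then p |P| would divide |M|, hence |G|, and cancelling |P| would make
  \<open>p\<close> divide the index of \<open>P\<close> in \<open>G\<close>.\<close>

lemma p_subgroup_subset_conj_in:
  assumes p: "Factorial_Ring.prime (p::nat)" and fin: "finite (carrier G)"
    and P: "sylow_subgroup G p P" and M: "subgroup M G" "P \<subseteq> M"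
    and Q: "p_subgroup G p Q" "Q \<subseteq> M"
  obtains g where "g \<in> M" "Q \<subseteq> conj_set G g P"
proof -
  interpret M: group "G\<lparr>carrier := M\<rparr>" using M(1) by (rule subgroup_imp_group)
  have Psub: "subgroup P G" using P by (simp add: sylow_subgroup_def)
  have PM: "subgroup P (G\<lparr>carrier := M\<rparr>)" using subgroup_incl[OF Psub M] .
  have finM: "finite M" using fin subgroup.subset[OF M(1)] finite_subset by blast
  have idx: "\<not> p dvd card (rcosets\<^bsub>G\<lparr>carrier := M\<rparr>\<^esub> P)"
  proof
    assume "p dvd card (rcosets\<^bsub>G\<lparr>carrier := M\<rparr>\<^esub> P)"
    then have "p * card P dvd card (rcosets\<^bsub>G\<lparr>carrier := M\<rparr>\<^esub> P) * card P"
      by (rule mult_dvd_mono) simp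
    then have "p * card P dvd card M" using M.lagrange[OF PM] by (simp add: Coset.order_def)
    also have "card M dvd Coset.order G" using lagrange[OF M(1)] by (metis dvd_triv_right)
    also have "Coset.order G = card (rcosets P) * card P" using lagrange[OF Psub] by simp
    finally have "p * card P dvd card (rcosets P) * card P" .
    moreover have "card P \<noteq> 0" using subgroup.finite_imp_card_positive[OF Psub fin] by simp
    ultimately have "p dvd card (rcosets P)" by simp
    then show False using sylow_not_dvd_index[OF p fin P] by simp
  qed
  have "p_subgroup (G\<lparr>carrier := M\<rparr>) p Q"
    using Q subgroup_incl[OF _ M(1)] by (simp add: p_subgroup_def)
  then obtain g where g: "g \<in> M" "Q \<subseteq> conj_set (G\<lparr>carrier := M\<rparr>) g P"
    using M.p_subgroup_subset_conj[OF p _ PM idx, of Q] finM by auto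
  moreover have "conj_set (G\<lparr>carrier := M\<rparr>) g P = conj_set G g P"
    using g(1) by (simp add: conj_set_def m_inv_consistent[OF M(1)])
  ultimately show thesis using that by simp
qed

lemma p_subgroup_subset_conj_sylow:
  assumes "Factorial_Ring.prime (p::nat)" "finite (carrier G)" "sylow_subgroup G p P" "p_subgroup G p Q"
  obtains g where "g \<in> carrier G" "Q \<subseteq> conj_set G g P"
  using p_subgroup_subset_conj[OF assms(1,2) _ sylow_not_dvd_index[OF assms(1-3)] assms(4)] assms(3)
  by (auto simp: sylow_subgroup_def)

lemma connected_if_no_strongly_embedded:
  assumes p: "Factorial_Ring.prime (p::nat)" and fin: "finite (carrier G)"
    and P: "sylow_subgroup G p P" "P \<noteq> {\<one>}"
    and noSE: "\<nexists>H. strongly_embedded G p H"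
    and H: "H \<in> nontrivial_p_subgroups G p"
  shows "poset_conn (nontrivial_p_subgroups G p) (\<subseteq>) H P"
proof -
  let ?S = "nontrivial_p_subgroups G p"
  let ?conn = "poset_conn ?S (\<subseteq>)"
  have PS: "P \<in> ?S"
    using P by (auto simp: nontrivial_p_subgroups_def sylow_subgroup_def p_subgroup_def)
  note Psub = nontrivial_p_subgroupsD[OF PS]
  \<comment> \<open>The stabiliser of the component of \<open>P\<close>. Testing the one point
    \<open>P\<close> suffices, because conjugation maps chains to chains.\<close>
  define M where "M = {g \<in> carrier G. ?conn (conj_set G g P) P}"
  have Msub: "subgroup M G"
  proof
    show "M \<subseteq> carrier G" by (auto simp: M_def)
    show "\<one> \<in> M" using Psub(3) by (simp add: M_def conj_set_one)
  next
    fix g assume g: "g \<in> M"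
    then have gc: "g \<in> carrier G" and gP: "?conn (conj_set G g P) P" by (auto simp: M_def)
    show "g \<otimes> h \<in> M" if "h \<in> M" for h
    proof -
      have hc: "h \<in> carrier G" and hP: "?conn (conj_set G h P) P" using that by (auto simp: M_def)
      have "?conn (conj_set G (g \<otimes> h) P) P"
        using poset_conn_trans[OF poset_conn_conj_set[OF gc hP] gP]
        by (simp add: conj_set_mult[OF gc hc Psub(3)])
      then show ?thesis using gc hc by (simp add: M_def)
    qed
    have "?conn P (conj_set G (inv g) P)"
      using poset_conn_conj_set[OF _ gP, of "inv g"] gc by (simp add: conj_set_inv_cancel Psub(3))
    then show "inv g \<in> M" using gc by (simp add: M_def poset_conn_sym)
  qed
  have PM: "P \<subseteq> M" using Psub(3) conj_set_self[OF Psub(2)] by (auto simp: M_def)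
  \<comment> \<open>\<open>R\<close> lies in a conjugate of \<open>P\<close> by an element of
    \<open>M\<close>, and such a conjugate stays in the component of \<open>P\<close>.\<close>
  have conn: "?conn R P" if R: "R \<in> ?S" "R \<subseteq> M" for R
  proof -
    obtain g where g: "g \<in> M" "R \<subseteq> conj_set G g P"
      using p_subgroup_subset_conj_in[OF p fin P(1) Msub PM nontrivial_p_subgroupsD(1)[OF R(1)] R(2)]
      by metis
    then have "g \<in> carrier G" "?conn (conj_set G g P) P" by (auto simp: M_def)
    moreover have "?conn R (conj_set G g P)"
      using g(2) R(1) conj_set_nontrivial_p_subgroup[OF \<open>g \<in> carrier G\<close> PS]
      by (rule poset_conn_step)
    ultimately show ?thesis using poset_conn_trans by metis
  qed
  have "M = carrier G"
  proof (rule ccontr)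
    assume "M \<noteq> carrier G"
    moreover have "p dvd card M"
      using p_dvd_card_p_subgroup[OF Psub(1,4)] card_subgroup_dvd[OF fin Psub(2) Msub PM] dvd_trans by blast
    \<comment> \<open>A subgroup \<open>R\<close> of order \<open>p\<close> in the intersection has
      both \<open>R\<close> and x R x^-1 inside \<open>M\<close>, so both are joined to
      \<open>P\<close>. Conjugating the chain from \<open>R\<close> to \<open>P\<close> by
      \<open>x\<close> joins x R x^-1 to x P x^-1, so \<open>x\<close> stabilises the component
      after all.\<close>
    moreover have "\<not> p dvd card (M \<inter> conj_set G (inv x) M)" if x: "x \<in> carrier G" "x \<notin> M" for x
    proof
      have Mx: "subgroup (M \<inter> conj_set G (inv x) M) G"
        using Msub x(1) by (intro subgroups_Inter_pair subgroup_conj_set) auto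
      assume "p dvd card (M \<inter> conj_set G (inv x) M)"
      then obtain R where R: "subgroup R G" "R \<subseteq> M \<inter> conj_set G (inv x) M" "card R = p"
        using cauchy_subgroup[OF p fin Mx] by metis
      have RS: "R \<in> ?S" using prime_order_nontrivial_p_subgroup[OF p R(1,3)] .
      have "conj_set G x R \<subseteq> conj_set G x (conj_set G (inv x) M)"
        using R(2) by (intro conj_set_mono) auto
      then have "conj_set G x R \<subseteq> M"
        using x(1) subgroup.subset[OF Msub] by (simp add: conj_set_inv_cancel)
      then have "?conn (conj_set G x R) P"
        using conn conj_set_nontrivial_p_subgroup[OF x(1) RS] by simp
      moreover have "?conn (conj_set G x R) (conj_set G x P)"
        using conn[OF RS] R(2) by (intro poset_conn_conj_set[OF x(1)]) simp
      ultimately have "?conn (conj_set G x P) P" using poset_conn_trans poset_conn_sym by metis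
      then show False using x by (simp add: M_def)
    qed
    ultimately have "strongly_embedded G p M" using Msub by (simp add: strongly_embedded_iff)
    then show False using noSE by simp
  qed
  then show ?thesis using conn[OF H] nontrivial_p_subgroupsD(3)[OF H] by simp
qed

end

section \<open>Irreducible and linear characters\<close>

lemma rep_props:
  assumes "group H" "is_rep H n \<rho>"
  shows "x \<in> carrier H \<Longrightarrow> \<rho> x \<in> carrier_mat n n"
    and "x \<in> carrier H \<Longrightarrow> y \<in> carrier H \<Longrightarrow> \<rho> (x \<otimes>\<^bsub>H\<^esub> y) = \<rho> x * \<rho> y"
    and "\<rho> \<one>\<^bsub>H\<^esub> = 1\<^sub>m n"
proof -
  have hom: "\<rho> \<in> hom H (GL n)" using assms(2) by (simp add: is_rep_def)
  interpret R: ring "ring_mat TYPE(complex) n ()" by (rule ring_mat)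
  have grp: "group (GL n)" unfolding GL_def by (rule R.units_group)
  show "x \<in> carrier H \<Longrightarrow> \<rho> x \<in> carrier_mat n n"
    using hom_in_carrier[OF hom] by (auto simp: GL_def units_of_def Units_def ring_mat_simps)
  show "x \<in> carrier H \<Longrightarrow> y \<in> carrier H \<Longrightarrow> \<rho> (x \<otimes>\<^bsub>H\<^esub> y) = \<rho> x * \<rho> y"
    using hom_mult[OF hom] by (auto simp: GL_def units_of_def ring_mat_simps)
  show "\<rho> \<one>\<^bsub>H\<^esub> = 1\<^sub>m n"
    using hom_one[OF hom assms(1) grp] by (auto simp: GL_def units_of_def ring_mat_simps)
qed

lemma irr_char_one_nonzero:
  assumes "group H" "\<phi> \<in> Irr H"
  shows "\<phi> \<one>\<^bsub>H\<^esub> \<noteq> 0"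
proof -
  obtain n \<rho> where \<phi>: "\<phi> = character_of H \<rho>" and irr: "irreducible_rep H n \<rho>"
    using assms(2) by (auto simp: Irr_def)
  then have n: "n > 0" and rep: "is_rep H n \<rho>" by (auto simp: irreducible_rep_def)
  have "\<one>\<^bsub>H\<^esub> \<in> carrier H" using assms(1) by (simp add: group.is_monoid monoid.one_closed)
  with n show ?thesis
    by (simp add: \<phi> character_of_def mat_trace_def rep_props(3)[OF assms(1) rep])
qed

text \<open>Schur's lemma by hand: the matrix of \<open>z\<close> has an eigenvalue over the complex
  numbers, centrality makes its eigenspace invariant, and irreducibility makes the eigenspace
  everything. The conclusion is \<phi>(hz) = \<lambda>(z) \<phi>(h) with \<lambda>(z) = \<phi>(z) /
  \<phi>(1) cleared of its denominator. Having it for all \<open>h\<close> in the group, not just on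
  the centre, is what allows inner products to be compared.\<close>

lemma irr_char_central:
  assumes "group H" "\<phi> \<in> Irr H" and z: "z \<in> carrier H"
    and central: "\<And>h. h \<in> carrier H \<Longrightarrow> z \<otimes>\<^bsub>H\<^esub> h = h \<otimes>\<^bsub>H\<^esub> z"
    and h: "h \<in> carrier H"
  shows "\<phi> \<one>\<^bsub>H\<^esub> * \<phi> (h \<otimes>\<^bsub>H\<^esub> z) = \<phi> z * \<phi> h"
proof -
  interpret group H by fact
  obtain n \<rho> where \<phi>: "\<phi> = character_of H \<rho>" and irr: "irreducible_rep H n \<rho>"
    using assms(2) by (auto simp: Irr_def)
  then have n: "n > 0" and rep: "is_rep H n \<rho>" by (auto simp: irreducible_rep_def)
  note rc = rep_props(1)[OF assms(1) rep] and rm = rep_props(2)[OF assms(1) rep]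
  define A where "A = \<rho> z"
  have A: "A \<in> carrier_mat n n" using rc z by (simp add: A_def)
  obtain k where "eigenvalue A k"
    using spectrum_non_empty[OF A n] by (auto simp: spectrum_def)
  then obtain v where v: "v \<in> carrier_vec n" "v \<noteq> 0\<^sub>v n" "A *\<^sub>v v = k \<cdot>\<^sub>v v"
    using A by (auto simp: eigenvalue_def eigenvector_def)
  define W where "W = {v \<in> carrier_vec n. A *\<^sub>v v = k \<cdot>\<^sub>v v}"
  interpret V: vec_space "TYPE(complex)" n .
  have sub: "VectorSpace.subspace class_ring W (module_vec TYPE(complex) n)"
    unfolding subspace_def submodule_def
    using A by (auto simp: W_def V.vectorspace_axioms V.module_axioms module_vec_simps
        mult_add_distrib_mat_vec smult_add_distrib_vec mult_mat_vec smult_smult_assoc mult.commute)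
  have inv: "\<rho> g *\<^sub>v w \<in> W" if g: "g \<in> carrier H" and w: "w \<in> W" for g w
  proof -
    have wc: "w \<in> carrier_vec n" and Aw: "A *\<^sub>v w = k \<cdot>\<^sub>v w" using w by (auto simp: W_def)
    have "A *\<^sub>v (\<rho> g *\<^sub>v w) = (A * \<rho> g) *\<^sub>v w"
      using A rc[OF g] wc by simp
    also have "A * \<rho> g = \<rho> g * A"
      using rm[OF z g] rm[OF g z] central[OF g] by (simp add: A_def)
    also have "(\<rho> g * A) *\<^sub>v w = k \<cdot>\<^sub>v (\<rho> g *\<^sub>v w)"
      using A rc[OF g] wc by (simp add: Aw mult_mat_vec)
    finally show ?thesis using rc[OF g] wc by (auto simp: W_def)
  qed
  have "W = {0\<^sub>v n} \<or> W = carrier_vec n"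
    using irr sub inv by (auto simp: irreducible_rep_def)
  moreover have "v \<in> W" using v by (simp add: W_def)
  ultimately have W: "W = carrier_vec n" using v by auto
  have Ak: "A = k \<cdot>\<^sub>m 1\<^sub>m n"
  proof (rule eq_matI)
    fix i j assume "i < dim_row (k \<cdot>\<^sub>m 1\<^sub>m n)" "j < dim_col (k \<cdot>\<^sub>m 1\<^sub>m n)"
    then have ij: "i < n" "j < n" by auto
    have "unit_vec n j \<in> W" using W by simp
    then have "(A *\<^sub>v unit_vec n j) $ i = k * unit_vec n j $ i" using ij by (simp add: W_def)
    moreover have "(A *\<^sub>v unit_vec n j) $ i = A $$ (i, j)"
      using A ij by (simp add: scalar_prod_right_unit)
    ultimately show "A $$ (i, j) = (k \<cdot>\<^sub>m 1\<^sub>m n) $$ (i, j)" using ij by simp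
  qed (use A in auto)
  have "\<phi> \<one>\<^bsub>H\<^esub> = of_nat n"
    using n by (simp add: \<phi> character_of_def mat_trace_def rep_props(3)[OF assms(1) rep])
  moreover have "\<phi> z = of_nat n * k"
    using z by (simp add: \<phi> character_of_def mat_trace_def A_def[symmetric] Ak)
  moreover have "\<phi> (h \<otimes>\<^bsub>H\<^esub> z) = k * \<phi> h"
  proof -
    have "\<rho> (h \<otimes>\<^bsub>H\<^esub> z) = k \<cdot>\<^sub>m \<rho> h"
      using rm[OF h z] rc[OF h] by (simp add: A_def[symmetric] Ak mult_smult_distrib[OF _ one_carrier_mat])
    then show ?thesis using h z rc[OF h]
      by (auto simp: \<phi> character_of_def mat_trace_def sum_distrib_left intro!: sum.cong)
  qed
  ultimately show ?thesis by simp
qed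

text \<open>\<chi>(x) \<chi>(x^-1) = 1 makes the 1 by 1 matrices invertible. Irreducibility is a
  matter of dimension: a non-zero vector of a subspace of a line spans the line.\<close>

lemma linear_char_in_Irr:
  assumes "group H"
    and mult: "\<And>x y. x \<in> carrier H \<Longrightarrow> y \<in> carrier H \<Longrightarrow> \<chi> (x \<otimes>\<^bsub>H\<^esub> y) = \<chi> x * \<chi> y"
    and one: "\<chi> \<one>\<^bsub>H\<^esub> = 1"
  shows "restrict \<chi> (carrier H) \<in> Irr H"
proof -
  interpret group H by fact
  define \<rho> where "\<rho> = (\<lambda>x. \<chi> x \<cdot>\<^sub>m 1\<^sub>m 1)"
  have mm: "\<rho> x * \<rho> y = \<rho> (x \<otimes>\<^bsub>H\<^esub> y)" if "x \<in> carrier H" "y \<in> carrier H" for x y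
    using mult[OF that] by (simp add: \<rho>_def) (rule eq_matI, auto)
  have "\<rho> x \<in> carrier (GL 1)" if x: "x \<in> carrier H" for x
  proof -
    have "\<rho> x * \<rho> (inv\<^bsub>H\<^esub> x) = 1\<^sub>m 1" "\<rho> (inv\<^bsub>H\<^esub> x) * \<rho> x = 1\<^sub>m 1"
      using mm[of x "inv\<^bsub>H\<^esub> x"] mm[of "inv\<^bsub>H\<^esub> x" x] x one by (auto simp: \<rho>_def)
    moreover have "\<rho> x \<in> carrier_mat 1 1" "\<rho> (inv\<^bsub>H\<^esub> x) \<in> carrier_mat 1 1" by (auto simp: \<rho>_def)
    ultimately show ?thesis by (auto simp: GL_def units_of_def Units_def ring_mat_simps)
  qed
  then have rep: "is_rep H 1 \<rho>"
    using mm by (auto simp: is_rep_def hom_def GL_def units_of_def ring_mat_simps)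
  have "W = {0\<^sub>v 1} \<or> W = carrier_vec 1"
    if sub: "VectorSpace.subspace class_ring W (module_vec TYPE(complex) 1)" for W
  proof -
    have sm: "submodule class_ring W (module_vec TYPE(complex) 1)"
      using sub by (simp add: subspace_def)
    have sc: "c \<cdot>\<^sub>v v \<in> W" if "v \<in> W" for c v
      using submodule.smult_closed[OF sm _ that] by (simp add: module_vec_simps class_ring_simps)
    have Wc: "W \<subseteq> carrier_vec 1" and W0: "0\<^sub>v 1 \<in> W"
      using submodule.subset[OF sm] submodule.zero_closed[OF sm] by (auto simp: module_vec_simps)
    show ?thesis
    proof (cases "W = {0\<^sub>v 1}")
      case False
      then obtain v where v: "v \<in> W" "v \<noteq> 0\<^sub>v 1" using W0 by auto
      then have d: "dim_vec v = 1" using Wc by auto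
      then have v0: "v $ 0 \<noteq> 0" using v(2) by (metis eq_vecI index_zero_vec less_one)
      have "w \<in> W" if w: "w \<in> carrier_vec 1" for w
      proof -
        have "w = (w $ 0 / v $ 0) \<cdot>\<^sub>v v" using w d v0 by (intro eq_vecI) auto
        then show ?thesis using sc[OF v(1)] by metis
      qed
      then show ?thesis using Wc by auto
    qed simp
  qed
  then have "irreducible_rep H 1 \<rho>" using rep by (auto simp: irreducible_rep_def)
  moreover have "character_of H \<rho> = restrict \<chi> (carrier H)"
    by (auto simp: character_of_def mat_trace_def \<rho>_def)
  ultimately show ?thesis unfolding Irr_def by auto metis
qed

section \<open>Linear characters of subgroups, above all of subgroups of prime order\<close>

definition lin_chars :: "('a, 'b) monoid_scheme \<Rightarrow> 'a set \<Rightarrow> ('a \<Rightarrow> complex) set" where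
  "lin_chars G A = {\<chi> \<in> extensional A. \<chi> \<one>\<^bsub>G\<^esub> = 1 \<and>
     (\<forall>x\<in>A. \<forall>y\<in>A. \<chi> (x \<otimes>\<^bsub>G\<^esub> y) = \<chi> x * \<chi> y)}"

text \<open>For f = c g the sum is the conjugate of \<open>c\<close> times the squared norm of
  \<open>g\<close>. This is how a pair with a linear character is shown to lie below another
  pair.\<close>

lemma sum_cnj_scalar_nonzero:
  assumes "finite Z" "Z \<noteq> {}" "c \<noteq> 0" "\<And>z. z \<in> Z \<Longrightarrow> g z \<noteq> 0" "\<And>z. z \<in> Z \<Longrightarrow> f z = c * g z"
  shows "(\<Sum>z\<in>Z. g z * cnj (f z)) \<noteq> 0"
proof -
  have "(\<Sum>z\<in>Z. g z * cnj (f z)) = (\<Sum>z\<in>Z. cnj c * of_real ((cmod (g z))\<^sup>2))"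
    using assms(5) by (intro sum.cong) (simp_all add: complex_norm_square[symmetric] mult.left_commute)
  also have "\<dots> = cnj c * of_real (\<Sum>z\<in>Z. (cmod (g z))\<^sup>2)" by (simp add: sum_distrib_left)
  finally have "(\<Sum>z\<in>Z. g z * cnj (f z)) = cnj c * of_real (\<Sum>z\<in>Z. (cmod (g z))\<^sup>2)" .
  moreover have "(\<Sum>z\<in>Z. (cmod (g z))\<^sup>2) > 0" using assms(1,2,4) by (intro sum_pos) auto
  ultimately show ?thesis using assms(3) by (metis complex_cnj_zero_iff less_irrefl mult_eq_0_iff of_real_eq_0_iff)
qed

context group
begin

lemma lin_charsD:
  assumes "\<chi> \<in> lin_chars G A"
  shows "\<chi> \<in> extensional A" "\<chi> \<one> = 1" "x \<in> A \<Longrightarrow> y \<in> A \<Longrightarrow> \<chi> (x \<otimes> y) = \<chi> x * \<chi> y"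
  using assms by (auto simp: lin_chars_def)

lemma lin_char_in_Irr:
  assumes "subgroup A G" "\<chi> \<in> lin_chars G A"
  shows "\<chi> \<in> Irr (G\<lparr>carrier := A\<rparr>)"
proof -
  have "restrict \<chi> (carrier (G\<lparr>carrier := A\<rparr>)) \<in> Irr (G\<lparr>carrier := A\<rparr>)"
    using lin_charsD[OF assms(2)] subgroup_imp_group[OF assms(1)]
    by (intro linear_char_in_Irr) simp_all
  then show ?thesis using lin_charsD(1)[OF assms(2)] by (simp add: extensional_restrict)
qed

text \<open>Since \<chi>(x) \<chi>(x^-1) = 1, the members of \<open>lin_chars\<close> are the
  homomorphisms into the non-zero complex numbers, made extensional to match the members of
  \<open>Irr\<close>.\<close>

lemma lin_char_nonzero:
  assumes "subgroup A G" "\<chi> \<in> lin_chars G A" "x \<in> A"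
  shows "\<chi> x \<noteq> 0"
proof -
  have "\<chi> x * \<chi> (inv x) = \<chi> (x \<otimes> inv x)"
    using lin_charsD(3)[OF assms(2,3) subgroup.m_inv_closed[OF assms(1,3)]] by simp
  also have "\<dots> = 1"
    using lin_charsD(2)[OF assms(2)] subgroup.subset[OF assms(1)] assms(3) by (simp add: subset_iff)
  finally show ?thesis by auto
qed

lemma subgroup_nat_pow_closed:
  assumes "subgroup A G" "a \<in> A"
  shows "a [^] (n::nat) \<in> A"
  using assms by (induction n) (simp_all add: subgroup.one_closed subgroup.m_closed)

lemma lin_char_nat_pow:
  assumes "subgroup A G" "\<chi> \<in> lin_chars G A" "a \<in> A"
  shows "\<chi> (a [^] (n::nat)) = \<chi> a ^ n"
proof (induction n)
  case (Suc n)
  then show ?case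
    using lin_charsD(3)[OF assms(2) subgroup_nat_pow_closed[OF assms(1,3), of n] assms(3)] by simp
qed (simp add: lin_charsD(2)[OF assms(2)])

lemma subgroup_pow_card:
  assumes "subgroup A G" "a \<in> A"
  shows "a [^] card A = \<one>"
proof -
  interpret A: group "G\<lparr>carrier := A\<rparr>" using assms(1) by (rule subgroup_imp_group)
  show ?thesis using A.pow_order_eq_1[of a] assms(2) by (simp add: Coset.order_def nat_pow_def)
qed

lemma prime_order_ord:
  assumes "Factorial_Ring.prime (p::nat)" "a \<in> carrier G" "a [^] p = \<one>" "a \<noteq> \<one>"
  shows "ord a = p"
proof -
  have "ord a dvd p" using pow_eq_id assms(2,3) by blast
  moreover have "ord a \<noteq> 1" using assms(2,4) pow_eq_id[of a 1] by auto
  ultimately show ?thesis using assms(1) prime_nat_iff by blast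
qed

lemma prime_order_cyclic:
  assumes p: "Factorial_Ring.prime (p::nat)" and A: "subgroup A G" "card A = p"
    and a: "a \<in> A" "a \<noteq> \<one>"
  shows "bij_betw (\<lambda>i::nat. a [^] i) {..<p} A"
proof -
  have ac: "a \<in> carrier G" using a(1) subgroup.subset[OF A(1)] by auto
  have "a [^] p = \<one>" using subgroup_pow_card[OF A(1) a(1)] A(2) by simp
  then have ord: "ord a = p" using prime_order_ord[OF p ac _ a(2)] by simp
  have "{0..p - 1} = {..<p}" using prime_gt_0_nat[OF p] by auto
  then have inj: "inj_on (\<lambda>i::nat. a [^] i) {..<p}" using ord_inj[OF ac] ord by simp
  have sub: "(\<lambda>i::nat. a [^] i) ` {..<p} \<subseteq> A" using subgroup_nat_pow_closed[OF A(1) a(1)] by auto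
  have "finite A" using A(2) prime_gt_0_nat[OF p] card_ge_0_finite by blast
  then have "(\<lambda>i::nat. a [^] i) ` {..<p} = A"
    using sub inj A(2) by (intro card_subset_eq) (simp_all add: card_image)
  with inj show ?thesis by (simp add: bij_betw_def)
qed

lemma prime_order_elem_pow:
  assumes "Factorial_Ring.prime (p::nat)" "subgroup A G" "card A = p" "a \<in> A" "a \<noteq> \<one>" "x \<in> A"
  obtains n :: nat where "x = a [^] n"
proof -
  have "x \<in> (\<lambda>i::nat. a [^] i) ` {..<p}"
    using prime_order_cyclic[OF assms(1-5)] assms(6) by (simp add: bij_betw_def)
  then show thesis using that by auto
qed

text \<open>Every non-trivial \<open>a\<close> generates \<open>A\<close>, so a character is
  determined by the \<open>p\<close>-th root of unity at \<open>a\<close>, and each root occurs.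
  Allowing any such \<open>a\<close> gives both the number of characters and, for each non-trivial
  element, a character that is not 1 there.\<close>

lemma lin_char_eval_bij:
  assumes p: "Factorial_Ring.prime (p::nat)" and A: "subgroup A G" "card A = p"
    and a: "a \<in> A" "a \<noteq> \<one>"
  shows "bij_betw (\<lambda>\<chi>. \<chi> a) (lin_chars G A) {\<omega>. \<omega> ^ p = 1}"
proof (rule bij_betw_imageI)
  note bij = prime_order_cyclic[OF p A a]
  have ac: "a \<in> carrier G" using a(1) subgroup.subset[OF A(1)] by auto
  have ap: "a [^] p = \<one>" using subgroup_pow_card[OF A(1) a(1)] A(2) by simp
  have mod: "a [^] (n mod p) = a [^] n" for n :: nat
  proof -
    have "a [^] n = a [^] (p * (n div p) + n mod p)" by simp
    also have "\<dots> = a [^] (p * (n div p)) \<otimes> a [^] (n mod p)" using ac by (simp only: nat_pow_mult)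
    also have "a [^] (p * (n div p)) = \<one>" using ac ap by (simp add: nat_pow_pow[symmetric])
    finally show ?thesis using ac by simp
  qed
  show "inj_on (\<lambda>\<chi>. \<chi> a) (lin_chars G A)"
  proof (rule inj_onI)
    fix \<chi> \<psi> assume \<chi>: "\<chi> \<in> lin_chars G A" and \<psi>: "\<psi> \<in> lin_chars G A" and eq: "\<chi> a = \<psi> a"
    show "\<chi> = \<psi>"
    proof (rule extensionalityI[OF lin_charsD(1)[OF \<chi>] lin_charsD(1)[OF \<psi>]])
      fix x assume "x \<in> A"
      then obtain n :: nat where n: "x = a [^] n" by (rule prime_order_elem_pow[OF p A a])
      show "\<chi> x = \<psi> x"
        by (simp add: n lin_char_nat_pow[OF A(1) \<chi> a(1)] lin_char_nat_pow[OF A(1) \<psi> a(1)] eq)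
    qed
  qed
  show "(\<lambda>\<chi>. \<chi> a) ` lin_chars G A = {\<omega>. \<omega> ^ p = 1}"
  proof (intro subset_antisym image_subsetI subsetI)
    fix \<chi> assume \<chi>: "\<chi> \<in> lin_chars G A"
    show "\<chi> a \<in> {\<omega>. \<omega> ^ p = 1}"
      using lin_char_nat_pow[OF A(1) \<chi> a(1), of p] ap lin_charsD(2)[OF \<chi>] by simp
  next
    fix \<omega> :: complex assume "\<omega> \<in> {\<omega>. \<omega> ^ p = 1}"
    then have \<omega>: "\<omega> ^ p = 1" by simp
    have \<omega>mod: "\<omega> ^ (n mod p) = \<omega> ^ n" for n
    proof -
      have "\<omega> ^ n = \<omega> ^ (p * (n div p) + n mod p)" by simp
      also have "\<dots> = \<omega> ^ (n mod p)" using \<omega> by (simp only: power_add power_mult) simp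
      finally show ?thesis by simp
    qed
    \<comment> \<open>\<open>inv_into\<close> is the discrete logarithm to base \<open>a\<close>,
      with values below \<open>p\<close>. Since powers of \<open>a\<close> and of
      \<open>\<omega>\<close> both depend only on the exponent modulo \<open>p\<close>, this choice
      of representative does no harm.\<close>
    define \<chi> where "\<chi> = (\<lambda>x\<in>A. \<omega> ^ inv_into {..<p} (\<lambda>i::nat. a [^] i) x)"
    have \<chi>: "\<chi> (a [^] n) = \<omega> ^ n" for n :: nat
    proof -
      have "inv_into {..<p} (\<lambda>i::nat. a [^] i) (a [^] (n mod p)) = n mod p"
        using bij prime_gt_0_nat[OF p] by (intro inv_into_f_f) (auto simp: bij_betw_def)
      then show ?thesis using subgroup_nat_pow_closed[OF A(1) a(1)] by (simp add: \<chi>_def mod \<omega>mod)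
    qed
    have "\<chi> \<in> lin_chars G A"
      unfolding lin_chars_def
    proof (intro CollectI conjI ballI)
      show "\<chi> \<in> extensional A" by (simp add: \<chi>_def)
      show "\<chi> \<one> = 1" using \<chi>[of 0] by simp
      fix x y assume x: "x \<in> A" and y: "y \<in> A"
      obtain m n :: nat where "x = a [^] m" "y = a [^] n"
        using prime_order_elem_pow[OF p A a x] prime_order_elem_pow[OF p A a y] by metis
      then show "\<chi> (x \<otimes> y) = \<chi> x * \<chi> y" using ac by (simp add: nat_pow_mult \<chi> power_add)
    qed
    moreover have "\<chi> a = \<omega>" using \<chi>[of 1] ac by simp
    ultimately show "\<omega> \<in> (\<lambda>\<chi>. \<chi> a) ` lin_chars G A" by blast
  qed
qed

lemma prime_order_nontrivial_elem:
  assumes "Factorial_Ring.prime (p::nat)" "subgroup A G" "card A = p"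
  obtains a where "a \<in> A" "a \<noteq> \<one>"
proof -
  have "A \<noteq> {\<one>}" using assms(1,3) by auto
  then show thesis using that subgroup.one_closed[OF assms(2)] by auto
qed

lemma lin_chars_card:
  assumes p: "Factorial_Ring.prime (p::nat)" and A: "subgroup A G" "card A = p"
  shows "card (lin_chars G A) = p" "finite (lin_chars G A)"
proof -
  obtain a where a: "a \<in> A" "a \<noteq> \<one>" by (rule prime_order_nontrivial_elem[OF p A])
  show "card (lin_chars G A) = p"
    using bij_betw_same_card[OF lin_char_eval_bij[OF p A a]] card_roots_unity_eq prime_gt_0_nat[OF p]
    by simp
  then show "finite (lin_chars G A)" using prime_gt_0_nat[OF p] card_ge_0_finite by metis
qed

text \<open>Multiplication by a character \<open>\<theta>\<close> with
  \<open>\<theta> x \<noteq> 1\<close> permutes the finite set of characters, so the sum equals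
  itself times \<theta>(x).\<close>

lemma lin_chars_sum_zero:
  assumes p: "Factorial_Ring.prime (p::nat)" and A: "subgroup A G" "card A = p"
    and x: "x \<in> A" "x \<noteq> \<one>"
  shows "(\<Sum>\<chi>\<in>lin_chars G A. \<chi> x) = 0"
proof -
  let ?L = "lin_chars G A"
  have "{\<omega>::complex. \<omega> ^ p = 1} \<noteq> {1}"
    using card_roots_unity_eq[of p] prime_gt_1_nat[OF p] by auto
  then obtain \<omega> :: complex where \<omega>: "\<omega> ^ p = 1" "\<omega> \<noteq> 1" by auto
  then have "\<omega> \<in> (\<lambda>\<chi>. \<chi> x) ` ?L"
    using lin_char_eval_bij[OF p A x] by (simp add: bij_betw_def)
  then obtain \<theta> where \<theta>: "\<theta> \<in> ?L" "\<theta> x = \<omega>" by auto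
  define m where "m \<chi> = (\<lambda>y\<in>A. \<theta> y * \<chi> y)" for \<chi> :: "'a \<Rightarrow> complex"
  have closed: "m ` ?L \<subseteq> ?L"
    using lin_charsD(2,3)[OF \<theta>(1)] subgroup.one_closed[OF A(1)] subgroup.m_closed[OF A(1)]
    by (auto simp: m_def lin_chars_def)
  have inj: "inj_on m ?L"
  proof (rule inj_onI)
    fix \<chi> \<psi> assume \<chi>: "\<chi> \<in> ?L" and \<psi>: "\<psi> \<in> ?L" and eq: "m \<chi> = m \<psi>"
    show "\<chi> = \<psi>"
    proof (rule extensionalityI[OF lin_charsD(1)[OF \<chi>] lin_charsD(1)[OF \<psi>]])
      fix y assume y: "y \<in> A"
      then have "\<theta> y * \<chi> y = \<theta> y * \<psi> y" using fun_cong[OF eq, of y] by (simp add: m_def)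
      then show "\<chi> y = \<psi> y" using lin_char_nonzero[OF A(1) \<theta>(1) y] by simp
    qed
  qed
  have "m ` ?L = ?L" using lin_chars_card(2)[OF p A] closed inj by (rule endo_inj_surj)
  then have "(\<Sum>\<chi>\<in>?L. \<chi> x) = (\<Sum>\<chi>\<in>m ` ?L. \<chi> x)" by simp
  also have "\<dots> = (\<Sum>\<chi>\<in>?L. m \<chi> x)" using inj by (simp add: sum.reindex)
  also have "\<dots> = \<omega> * (\<Sum>\<chi>\<in>?L. \<chi> x)" using x(1) \<theta>(2) by (simp add: m_def sum_distrib_left)
  finally show ?thesis using \<omega>(2) by simp
qed

text \<open>Fourier inversion at the identity: if all coefficients of \<open>f\<close> vanished, so would \<open>f \<one>\<close>.\<close>

lemma lin_constituent_exists:
  assumes p: "Factorial_Ring.prime (p::nat)" and A: "subgroup A G" "card A = p"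
    and f: "f \<one> \<noteq> 0"
  obtains \<chi> where "\<chi> \<in> lin_chars G A" "(\<Sum>x\<in>A. \<chi> x * cnj (f x)) \<noteq> 0"
proof (rule ccontr)
  let ?L = "lin_chars G A"
  have finA: "finite A" using A(2) prime_gt_0_nat[OF p] card_ge_0_finite by blast
  assume "\<not> thesis"
  then have zero: "(\<Sum>x\<in>A. \<chi> x * cnj (f x)) = 0" if "\<chi> \<in> ?L" for \<chi>
    using that \<open>\<And>\<chi>. \<chi> \<in> ?L \<Longrightarrow> (\<Sum>x\<in>A. \<chi> x * cnj (f x)) \<noteq> 0 \<Longrightarrow> thesis\<close> by blast
  have "0 = (\<Sum>\<chi>\<in>?L. \<Sum>x\<in>A. \<chi> x * cnj (f x))" using zero by simp
  also have "\<dots> = (\<Sum>x\<in>A. (\<Sum>\<chi>\<in>?L. \<chi> x) * cnj (f x))"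
    by (subst sum.swap) (simp add: sum_distrib_right)
  also have "\<dots> = (\<Sum>x\<in>A. if x = \<one> then of_nat p * cnj (f \<one>) else 0)"
    using lin_chars_sum_zero[OF p A] lin_chars_card[OF p A]
    by (intro sum.cong) (auto simp: lin_charsD(2))
  also have "\<dots> = of_nat p * cnj (f \<one>)" using finA subgroup.one_closed[OF A(1)] by simp
  finally show False using f prime_gt_0_nat[OF p] by simp
qed

lemma prime_order_subgroups_Int:
  assumes p: "Factorial_Ring.prime (p::nat)" and fin: "finite (carrier G)"
    and A: "subgroup A G" "card A = p" and B: "subgroup B G" "card B = p" and ne: "A \<noteq> B"
  shows "A \<inter> B = {\<one>}"
proof -
  have I: "subgroup (A \<inter> B) G" using A(1) B(1) by (rule subgroups_Inter_pair)
  have "finite A" "finite B" using A(1) B(1) fin subgroup.subset finite_subset by metis+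
  then have "card (A \<inter> B) \<noteq> p"
    using ne A(2) B(2) card_subset_eq[of A "A \<inter> B"] card_subset_eq[of B "A \<inter> B"] by auto
  moreover have "card (A \<inter> B) dvd p" using card_subgroup_dvd[OF fin I A(1)] A(2) by simp
  ultimately have "card (A \<inter> B) = 1" using p prime_nat_iff by blast
  then show ?thesis using subgroup.one_closed[OF I] by (metis card_1_singletonE singletonD)
qed

text \<open>\<open>E\<close> is the internal direct product, of order \<open>p ^ 2\<close>. The
  trivial intersection makes the factorisation ab unique, so \<mu>(ab) = \<chi>(a) is well defined;
  commutation makes \<open>E\<close> a subgroup and \<open>\<mu>\<close> multiplicative.\<close>

lemma commuting_product:
  assumes p: "Factorial_Ring.prime (p::nat)" and fin: "finite (carrier G)"
    and A: "subgroup A G" "card A = p" and B: "subgroup B G" "card B = p" and ne: "A \<noteq> B"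
    and comm: "\<And>a b. a \<in> A \<Longrightarrow> b \<in> B \<Longrightarrow> a \<otimes> b = b \<otimes> a"
    and \<chi>: "\<chi> \<in> lin_chars G A"
  obtains E \<mu> where "p_subgroup G p E" "A \<subseteq> E" "B \<subseteq> E" "\<mu> \<in> lin_chars G E"
    "\<And>a. a \<in> A \<Longrightarrow> \<mu> a = \<chi> a" "\<And>b. b \<in> B \<Longrightarrow> \<mu> b = 1"
proof -
  define f where "f = (\<lambda>(a, b). a \<otimes> b)"
  define E where "E = f ` (A \<times> B)"
  define \<mu> where "\<mu> = (\<lambda>e\<in>E. \<chi> (fst (inv_into (A \<times> B) f e)))"
  have Ac: "a \<in> carrier G" if "a \<in> A" for a using subgroup.subset[OF A(1)] that by auto
  have Bc: "b \<in> carrier G" if "b \<in> B" for b using subgroup.subset[OF B(1)] that by auto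
  have EI: "a \<otimes> b \<in> E" if "a \<in> A" "b \<in> B" for a b using that by (force simp: E_def f_def)
  have EE: thesis if "e \<in> E" "\<And>a b. a \<in> A \<Longrightarrow> b \<in> B \<Longrightarrow> e = a \<otimes> b \<Longrightarrow> thesis" for e thesis
    using that by (auto simp: E_def f_def)
  have inj: "inj_on f (A \<times> B)"
  proof (rule inj_onI, clarify)
    fix a b a' b' assume ab: "a \<in> A" "b \<in> B" "a' \<in> A" "b' \<in> B" and "f (a, b) = f (a', b')"
    then have eq: "a \<otimes> b = a' \<otimes> b'" by (simp add: f_def)
    note c = Ac[OF ab(1)] Bc[OF ab(2)] Ac[OF ab(3)] Bc[OF ab(4)]
    have "inv a' \<otimes> a = inv a' \<otimes> (a \<otimes> b) \<otimes> inv b" using c by (simp add: m_assoc)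
    also have "\<dots> = b' \<otimes> inv b" using c by (simp add: eq m_assoc[symmetric])
    finally have eq': "inv a' \<otimes> a = b' \<otimes> inv b" .
    have "inv a' \<otimes> a \<in> A" "b' \<otimes> inv b \<in> B"
      using ab A(1) B(1) by (simp_all add: subgroup.m_closed subgroup.m_inv_closed)
    then have "inv a' \<otimes> a = \<one>" "b' \<otimes> inv b = \<one>"
      using eq' prime_order_subgroups_Int[OF p fin A B ne] by auto
    then show "a = a' \<and> b = b'" using c by (metis inv_closed inv_equality inv_inv r_inv)
  qed
  have \<mu>: "\<mu> (a \<otimes> b) = \<chi> a" if "a \<in> A" "b \<in> B" for a b
    using EI[OF that] inv_into_f_f[OF inj, of "(a, b)"] that by (simp add: \<mu>_def f_def)
  have mult: "(a \<otimes> b) \<otimes> (a' \<otimes> b') = (a \<otimes> a') \<otimes> (b \<otimes> b')"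
    if "a \<in> A" "b \<in> B" "a' \<in> A" "b' \<in> B" for a b a' b'
  proof -
    note c = Ac[OF that(1)] Bc[OF that(2)] Ac[OF that(3)] Bc[OF that(4)]
    have "(a \<otimes> b) \<otimes> (a' \<otimes> b') = a \<otimes> (b \<otimes> a') \<otimes> b'" using c by (simp add: m_assoc)
    also have "b \<otimes> a' = a' \<otimes> b" using comm[OF that(3,2)] by simp
    finally show ?thesis using c by (simp add: m_assoc)
  qed
  have one: "\<one> \<in> A" "\<one> \<in> B" using A(1) B(1) subgroup.one_closed by auto
  have Esub: "subgroup E G"
  proof
    show "E \<subseteq> carrier G" using Ac Bc by (auto elim: EE)
    show "\<one> \<in> E" using EI[OF one] by simp
    fix x assume "x \<in> E"
    then obtain a b where x: "a \<in> A" "b \<in> B" "x = a \<otimes> b" by (rule EE)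
    have "inv x = inv b \<otimes> inv a" using x Ac Bc by (simp add: inv_mult_group)
    also have "\<dots> = inv a \<otimes> inv b"
      using comm[of "inv a" "inv b"] x A(1) B(1) by (simp add: subgroup.m_inv_closed)
    finally show "inv x \<in> E" using EI x A(1) B(1) by (simp add: subgroup.m_inv_closed)
    fix y assume "y \<in> E"
    then obtain a' b' where y: "a' \<in> A" "b' \<in> B" "y = a' \<otimes> b'" by (rule EE)
    show "x \<otimes> y \<in> E"
      using EI x y A(1) B(1) by (simp add: mult subgroup.m_closed)
  qed
  have "card E = p ^ 2"
    using inj A(2) B(2) by (simp add: E_def card_image card_cartesian_product power2_eq_square)
  then have Ep: "p_subgroup G p E" using Esub unfolding p_subgroup_def by blast
  have "\<mu> \<in> lin_chars G E"
    unfolding lin_chars_def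
  proof (intro CollectI conjI ballI)
    show "\<mu> \<in> extensional E" by (simp add: \<mu>_def)
    show "\<mu> \<one> = 1" using \<mu>[OF one] lin_charsD(2)[OF \<chi>] by simp
    fix x y assume "x \<in> E" "y \<in> E"
    then obtain a b a' b' where x: "a \<in> A" "b \<in> B" "x = a \<otimes> b" and y: "a' \<in> A" "b' \<in> B" "y = a' \<otimes> b'"
      by (metis EE)
    then show "\<mu> (x \<otimes> y) = \<mu> x * \<mu> y"
      using A(1) B(1) by (simp add: mult \<mu> subgroup.m_closed lin_charsD(3)[OF \<chi>])
  qed
  moreover have "A \<subseteq> E" using EI[OF _ one(2)] Ac by fastforce
  moreover have "B \<subseteq> E" using EI[OF one(1)] Bc by fastforce
  moreover have "\<mu> a = \<chi> a" if "a \<in> A" for a using \<mu>[OF that one(2)] Ac[OF that] by simp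
  moreover have "\<mu> b = 1" if "b \<in> B" for b
    using \<mu>[OF one(1) that] Bc[OF that] lin_charsD(2)[OF \<chi>] by simp
  ultimately show thesis using that Ep by metis
qed

end

section \<open>The poset of characters of \<open>p\<close>-subgroups\<close>

definition triv_char :: "'a set \<Rightarrow> 'a \<Rightarrow> complex" where
  "triv_char H = (\<lambda>x\<in>H. 1)"

context group
begin

lemma Gamma_iff:
  "(H, \<phi>) \<in> Gamma G p \<longleftrightarrow> H \<in> nontrivial_p_subgroups G p \<and> \<phi> \<in> Irr (G\<lparr>carrier := H\<rparr>)"
  by (simp add: Gamma_def nontrivial_p_subgroups_def)

lemma Gamma_le_iff:
  assumes "finite (carrier G)" "subgroup H G"
  shows "Gamma_le G (H, \<phi>) (K, \<psi>) \<longleftrightarrow> H \<subseteq> K \<and> (\<Sum>h\<in>H. \<phi> h * cnj (\<psi> h)) \<noteq> 0"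
proof -
  have "card H > 0" using subgroup.finite_imp_card_positive[OF assms(2,1)] .
  then show ?thesis by (simp add: Gamma_le_def char_inner_def Coset.order_def)
qed

lemma subgroup_in_subgroup_iff:
  assumes "subgroup P G"
  shows "subgroup Q (G\<lparr>carrier := P\<rparr>) \<longleftrightarrow> subgroup Q G \<and> Q \<subseteq> P"
  using incl_subgroup[OF assms] subgroup_incl[OF _ assms] subgroup.subset[of Q "G\<lparr>carrier := P\<rparr>"]
  by auto

lemma triv_char_in_lin_chars: "subgroup H G \<Longrightarrow> triv_char H \<in> lin_chars G H"
  by (auto simp: triv_char_def lin_chars_def subgroup.one_closed subgroup.m_closed)

lemma triv_char_Gamma: "H \<in> nontrivial_p_subgroups G p \<Longrightarrow> (H, triv_char H) \<in> Gamma G p"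
  using nontrivial_p_subgroupsD(2) lin_char_in_Irr triv_char_in_lin_chars by (simp add: Gamma_iff)

lemma lin_char_Gamma_le:
  assumes fin: "finite (carrier G)" and A: "subgroup A G" "A \<subseteq> H"
    and \<chi>: "\<chi> \<in> lin_chars G A" and c: "c \<noteq> 0" "\<And>a. a \<in> A \<Longrightarrow> \<phi> a = c * \<chi> a"
  shows "Gamma_le G (A, \<chi>) (H, \<phi>)"
proof -
  have "finite A" using fin A(1) subgroup.subset finite_subset by metis
  moreover have "A \<noteq> {}" using subgroup.one_closed[OF A(1)] by auto
  ultimately have "(\<Sum>a\<in>A. \<chi> a * cnj (\<phi> a)) \<noteq> 0"
    using c(1) lin_char_nonzero[OF A(1) \<chi>] c(2) by (rule sum_cnj_scalar_nonzero)
  then show ?thesis using A(2) by (simp add: Gamma_le_iff[OF fin A(1)])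
qed

lemma strongly_embedded_Gamma_disconnected:
  assumes p: "Factorial_Ring.prime (p::nat)" and fin: "finite (carrier G)"
    and M: "strongly_embedded G p M"
  shows "poset_disconnected (Gamma G p) (Gamma_le G)"
proof -
  let ?S = "nontrivial_p_subgroups G p"
  obtain H K where HK: "H \<in> ?S" "K \<in> ?S" "\<not> poset_conn ?S (\<subseteq>) H K"
    by (rule strongly_embedded_disconnected[OF p fin M])
  have "poset_conn ?S (\<subseteq>) (fst x) (fst y)" if "poset_conn (Gamma G p) (Gamma_le G) x y" for x y
    using that
  proof (rule poset_conn_map[rotated])
    fix a b assume "a \<in> Gamma G p" "b \<in> Gamma G p" "Gamma_le G a b"
    then show "poset_conn ?S (\<subseteq>) (fst a) (fst b)"
      by (cases a; cases b) (auto simp: Gamma_iff Gamma_le_def intro: poset_conn_step)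
  qed
  \<comment> \<open>The trivial characters supply points of \<open>Gamma\<close> above
    \<open>H\<close> and \<open>K\<close>.\<close>
  then have "\<not> poset_conn (Gamma G p) (Gamma_le G) (H, triv_char H) (K, triv_char K)"
    using HK(3) by fastforce
  then show ?thesis using triv_char_Gamma HK(1,2) unfolding poset_disconnected_iff by blast
qed

text \<open>Let \<open>T\<close> be a Sylow conjugate containing \<open>A\<close>, with a central
  subgroup \<open>Z\<close> of order \<open>p\<close>. If \<open>A\<close> is not \<open>Z\<close>,
  then \<open>Z\<close> itself commutes with \<open>A\<close>. If it is, then \<open>A\<close> is
  central in \<open>T\<close>, and one of the two distinct conjugates of \<open>Q\<close> and
  \<open>R\<close> inside \<open>T\<close> differs from \<open>A\<close>.\<close>

lemma commuting_prime_order_subgroup: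
  assumes p: "Factorial_Ring.prime (p::nat)" and fin: "finite (carrier G)" and P: "sylow_subgroup G p P"
    and Q: "subgroup Q G" "card Q = p" "Q \<subseteq> P" and R: "subgroup R G" "card R = p" "R \<subseteq> P" "Q \<noteq> R"
    and A: "subgroup A G" "card A = p"
  obtains B where "subgroup B G" "card B = p" "A \<noteq> B" "\<And>a b. a \<in> A \<Longrightarrow> b \<in> B \<Longrightarrow> a \<otimes> b = b \<otimes> a"
proof -
  note sub = nontrivial_p_subgroupsD[OF prime_order_nontrivial_p_subgroup[OF p]]
  obtain g where g: "g \<in> carrier G" "A \<subseteq> conj_set G g P"
    by (rule p_subgroup_subset_conj_sylow[OF p fin P sub(1)[OF A]])
  define T where "T = conj_set G g P"
  have Pp: "p_subgroup G p P" using P by (auto simp: sylow_subgroup_def p_subgroup_def)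
  have T: "p_subgroup G p T" unfolding T_def using g(1) Pp by (rule p_subgroup_conj_set)
  have "T \<noteq> {\<one>}" using sub(4)[OF A] g(2) subgroup.one_closed[OF A(1)] by (auto simp: T_def)
  then obtain Z where Z: "subgroup Z G" "Z \<subseteq> T" "card Z = p"
    and comm: "\<And>z h. z \<in> Z \<Longrightarrow> h \<in> T \<Longrightarrow> z \<otimes> h = h \<otimes> z"
    using p_subgroup_central[OF p fin T] by metis
  show thesis
  proof (cases "A = Z")
    case False
    show thesis
    proof (rule that[OF Z(1,3) False])
      fix a b assume "a \<in> A" "b \<in> Z"
      then show "a \<otimes> b = b \<otimes> a" using comm[of b a] g(2) by (auto simp: T_def)
    qed
  next
    case True
    have "conj_set G g Q \<noteq> conj_set G g R"
      using conj_set_inv_cancel(1)[OF g(1)] Q(1) R(1,4) subgroup.subset by metis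
    then obtain B0 where B0: "B0 = Q \<or> B0 = R" "conj_set G g B0 \<noteq> A" by metis
    have B: "subgroup B0 G" "card B0 = p" "B0 \<subseteq> P" using B0(1) Q R by auto
    show thesis
    proof (rule that[of "conj_set G g B0"])
      show "subgroup (conj_set G g B0) G" using g(1) B(1) by (rule subgroup_conj_set)
      show "card (conj_set G g B0) = p"
        using card_conj_set[OF g(1) subgroup.subset[OF B(1)]] B(2) by simp
      fix a b assume "a \<in> A" "b \<in> conj_set G g B0"
      then show "a \<otimes> b = b \<otimes> a"
        using comm[of a b] True conj_set_mono[OF B(3), of G g] by (auto simp: T_def)
    qed (use B0(2) in auto)
  qed
qed

text \<open>The zigzag is (H, \<phi>) \<ge> (A, \<chi>) \<le> (E, \<mu>) \<ge> (B, 1_B).\<close>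

lemma Gamma_connected_to_triv_char:
  assumes p: "Factorial_Ring.prime (p::nat)" and fin: "finite (carrier G)" and P: "sylow_subgroup G p P"
    and Q: "subgroup Q G" "card Q = p" "Q \<subseteq> P" and R: "subgroup R G" "card R = p" "R \<subseteq> P" "Q \<noteq> R"
    and H: "(H, \<phi>) \<in> Gamma G p"
  obtains B where "B \<in> nontrivial_p_subgroups G p"
    "poset_conn (Gamma G p) (Gamma_le G) (H, \<phi>) (B, triv_char B)"
proof -
  let ?conn = "poset_conn (Gamma G p) (Gamma_le G)"
  note nt = prime_order_nontrivial_p_subgroup[OF p]
  have HS: "H \<in> nontrivial_p_subgroups G p" and \<phi>: "\<phi> \<in> Irr (G\<lparr>carrier := H\<rparr>)"
    using H by (auto simp: Gamma_iff)
  note Hs = nontrivial_p_subgroupsD[OF HS]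
  obtain A where A: "subgroup A G" "A \<subseteq> H" "card A = p"
    using cauchy_subgroup[OF p fin Hs(2) p_dvd_card_p_subgroup[OF Hs(1,4)]] by metis
  have "\<phi> \<one> \<noteq> 0" using irr_char_one_nonzero[OF subgroup_imp_group[OF Hs(2)] \<phi>] by simp
  then obtain \<chi> where \<chi>: "\<chi> \<in> lin_chars G A" "(\<Sum>x\<in>A. \<chi> x * cnj (\<phi> x)) \<noteq> 0"
    using lin_constituent_exists[OF p A(1,3), of \<phi>] by metis
  have AG: "(A, \<chi>) \<in> Gamma G p"
    using nt[OF A(1,3)] lin_char_in_Irr[OF A(1) \<chi>(1)] by (simp add: Gamma_iff)
  obtain B where B: "subgroup B G" "card B = p" "A \<noteq> B"
    and comm: "\<And>a b. a \<in> A \<Longrightarrow> b \<in> B \<Longrightarrow> a \<otimes> b = b \<otimes> a"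
    using commuting_prime_order_subgroup[OF p fin P Q R A(1,3)] by metis
  obtain E \<mu> where E: "p_subgroup G p E" "A \<subseteq> E" "B \<subseteq> E" and \<mu>: "\<mu> \<in> lin_chars G E"
    "\<And>a. a \<in> A \<Longrightarrow> \<mu> a = \<chi> a" "\<And>b. b \<in> B \<Longrightarrow> \<mu> b = 1"
    using commuting_product[OF p fin A(1,3) B comm \<chi>(1)] by metis
  have "E \<noteq> {\<one>}"
    using E(2) nontrivial_p_subgroupsD(4)[OF nt[OF A(1,3)]] subgroup.one_closed[OF A(1)] by auto
  then have ES: "E \<in> nontrivial_p_subgroups G p" using E(1) by (simp add: nontrivial_p_subgroups_def)
  then have EG: "(E, \<mu>) \<in> Gamma G p"
    using lin_char_in_Irr[OF nontrivial_p_subgroupsD(2) \<mu>(1)] by (simp add: Gamma_iff)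
  have "Gamma_le G (A, \<chi>) (H, \<phi>)" using A(2) \<chi>(2) by (simp add: Gamma_le_iff[OF fin A(1)])
  then have 1: "?conn (A, \<chi>) (H, \<phi>)" using AG H by (rule poset_conn_step)
  have "Gamma_le G (A, \<chi>) (E, \<mu>)"
    using \<mu>(2) by (intro lin_char_Gamma_le[OF fin A(1) E(2) \<chi>(1), of 1]) simp_all
  then have 2: "?conn (A, \<chi>) (E, \<mu>)" using AG EG by (rule poset_conn_step)
  have "Gamma_le G (B, triv_char B) (E, \<mu>)"
    using \<mu>(3) by (intro lin_char_Gamma_le[OF fin B(1) E(3) triv_char_in_lin_chars[OF B(1)], of 1])
      (simp_all add: triv_char_def)
  then have 3: "?conn (B, triv_char B) (E, \<mu>)"
    using triv_char_Gamma[OF nt[OF B(1,2)]] EG by (rule poset_conn_step)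
  have "?conn (H, \<phi>) (B, triv_char B)"
    using 1 2 3 poset_conn_trans poset_conn_sym by metis
  then show thesis using that nt[OF B(1,2)] by blast
qed

lemma Gamma_not_disconnected:
  assumes p: "Factorial_Ring.prime (p::nat)" and fin: "finite (carrier G)" and P: "sylow_subgroup G p P"
    and nunique: "\<nexists>!Q. subgroup Q (G\<lparr>carrier := P\<rparr>) \<and> card Q = p"
    and noSE: "\<nexists>H. strongly_embedded G p H"
  shows "\<not> poset_disconnected (Gamma G p) (Gamma_le G)"
proof
  let ?S = "nontrivial_p_subgroups G p"
  let ?conn = "poset_conn (Gamma G p) (Gamma_le G)"
  have Psub: "subgroup P G" and Pp: "p_subgroup G p P"
    using P by (auto simp: sylow_subgroup_def p_subgroup_def)
  assume "poset_disconnected (Gamma G p) (Gamma_le G)"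
  then obtain H \<phi> K \<psi> where HK: "(H, \<phi>) \<in> Gamma G p" "(K, \<psi>) \<in> Gamma G p" "\<not> ?conn (H, \<phi>) (K, \<psi>)"
    by (auto simp: poset_disconnected_iff)
  have HS: "H \<in> ?S" using HK(1) by (simp add: Gamma_iff)
  note Hs = nontrivial_p_subgroupsD[OF HS]
  \<comment> \<open>If \<open>P\<close> were trivial, so would be every \<open>p\<close>-subgroup,
    and \<open>Gamma\<close> would be empty; the point over \<open>H\<close> excludes this.\<close>
  have Pnt: "P \<noteq> {\<one>}"
  proof
    assume "P = {\<one>}"
    then obtain g where "g \<in> carrier G" "H \<subseteq> conj_set G g {\<one>}"
      using p_subgroup_subset_conj_sylow[OF p fin P Hs(1)] by metis
    then have "H \<subseteq> {\<one>}" by (simp add: conj_set_trivial)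
    then show False using Hs(4) subgroup.one_closed[OF Hs(2)] by auto
  qed
  obtain Q where Q: "subgroup Q G" "Q \<subseteq> P" "card Q = p"
    using cauchy_subgroup[OF p fin Psub p_dvd_card_p_subgroup[OF Pp Pnt]] by metis
  obtain R where R: "subgroup R G" "R \<subseteq> P" "card R = p" "Q \<noteq> R"
    using nunique Q unfolding subgroup_in_subgroup_iff[OF Psub] by metis
  note link = Gamma_connected_to_triv_char[OF p fin P Q(1,3,2) R(1,3,2,4)]
  have triv: "?conn (A, triv_char A) (B, triv_char B)" if "poset_conn ?S (\<subseteq>) A B" for A B
    using that
  proof (rule poset_conn_map[rotated])
    fix A B assume AB: "A \<in> ?S" "B \<in> ?S" "A \<subseteq> B"
    have "Gamma_le G (A, triv_char A) (B, triv_char B)"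
      using AB(3) nontrivial_p_subgroupsD(2)[OF AB(1)]
      by (intro lin_char_Gamma_le[OF fin _ AB(3), of _ 1] triv_char_in_lin_chars) (auto simp: triv_char_def)
    then show "?conn (A, triv_char A) (B, triv_char B)"
      using triv_char_Gamma AB(1,2) by (intro poset_conn_step)
  qed
  have "?conn (L, \<theta>) (P, triv_char P)" if L: "(L, \<theta>) \<in> Gamma G p" for L \<theta>
  proof -
    obtain B where B: "B \<in> ?S" "?conn (L, \<theta>) (B, triv_char B)" by (rule link[OF L])
    then show ?thesis
      using triv[OF connected_if_no_strongly_embedded[OF p fin P Pnt noSE B(1)]] poset_conn_trans by metis
  qed
  then show False using HK poset_conn_trans poset_conn_sym by metis
qed

section \<open>The case of a unique subgroup of order p: counting components\<close>

lemma unique_prime_order_in_p_subgroup: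
  assumes p: "Factorial_Ring.prime (p::nat)" and fin: "finite (carrier G)" and P: "sylow_subgroup G p P"
    and unique: "\<exists>!Q. subgroup Q (G\<lparr>carrier := P\<rparr>) \<and> card Q = p"
    and H: "p_subgroup G p H" and A: "subgroup A G" "A \<subseteq> H" "card A = p"
    and B: "subgroup B G" "B \<subseteq> H" "card B = p"
  shows "A = B"
proof -
  have Psub: "subgroup P G" using P by (simp add: sylow_subgroup_def)
  note Pc = subgroup.subset[OF Psub]
  obtain g where g: "g \<in> carrier G" "H \<subseteq> conj_set G g P"
    by (rule p_subgroup_subset_conj_sylow[OF p fin P H])
  have *: "subgroup (conj_set G (inv g) C) G \<and> conj_set G (inv g) C \<subseteq> P \<and> card (conj_set G (inv g) C) = p"
    if C: "subgroup C G" "C \<subseteq> H" "card C = p" for C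
  proof (intro conjI)
    show "subgroup (conj_set G (inv g) C) G" using g(1) C(1) by (simp add: subgroup_conj_set)
    have "conj_set G (inv g) C \<subseteq> conj_set G (inv g) (conj_set G g P)"
      using C(2) g(2) by (intro conj_set_mono) auto
    then show "conj_set G (inv g) C \<subseteq> P" using conj_set_inv_cancel(1)[OF g(1) Pc] by simp
    show "card (conj_set G (inv g) C) = p"
      using card_conj_set[of "inv g" C] g(1) subgroup.subset[OF C(1)] C(3) by simp
  qed
  have "conj_set G (inv g) A = conj_set G (inv g) B"
    using unique *[OF A] *[OF B] unfolding subgroup_in_subgroup_iff[OF Psub] by metis
  then show ?thesis
    using conj_set_inv_cancel(2)[OF g(1)] subgroup.subset A(1) B(1) by metis
qed

text \<open>A formula for the subgroup of order \<open>p\<close> instead of a choice of it, and the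
  generating set in \<open>Omega1\<close>. That it is a subgroup comes from uniqueness, in
  \<open>p_torsion_unique\<close>.\<close>

definition p_torsion :: "nat \<Rightarrow> 'a set \<Rightarrow> 'a set" where
  "p_torsion p H = {x \<in> H. x [^] p = \<one>}"

text \<open>A non-trivial \<open>x\<close> in \<open>H\<close> with x^p = 1 generates a subgroup of
  order \<open>p\<close>, which by uniqueness is the central one.\<close>

lemma p_torsion_unique:
  assumes p: "Factorial_Ring.prime (p::nat)" and fin: "finite (carrier G)" and P: "sylow_subgroup G p P"
    and unique: "\<exists>!Q. subgroup Q (G\<lparr>carrier := P\<rparr>) \<and> card Q = p"
    and H: "H \<in> nontrivial_p_subgroups G p"
  shows "subgroup (p_torsion p H) G" "card (p_torsion p H) = p"
    and "\<And>z h. z \<in> p_torsion p H \<Longrightarrow> h \<in> H \<Longrightarrow> z \<otimes> h = h \<otimes> z"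
    and "\<And>A. subgroup A G \<Longrightarrow> A \<subseteq> H \<Longrightarrow> card A = p \<Longrightarrow> p_torsion p H = A"
proof -
  note Hs = nontrivial_p_subgroupsD[OF H]
  note uniq = unique_prime_order_in_p_subgroup[OF p fin P unique Hs(1)]
  obtain Z where Z: "subgroup Z G" "Z \<subseteq> H" "card Z = p"
    and comm: "\<And>z h. z \<in> Z \<Longrightarrow> h \<in> H \<Longrightarrow> z \<otimes> h = h \<otimes> z"
    using p_subgroup_central[OF p fin Hs(1,4)] by metis
  have eq: "p_torsion p H = Z"
  proof
    show "Z \<subseteq> p_torsion p H"
      using Z subgroup_pow_card[OF Z(1)] by (auto simp: p_torsion_def)
    show "p_torsion p H \<subseteq> Z"
    proof
      fix x assume "x \<in> p_torsion p H"
      then have x: "x \<in> H" "x \<in> carrier G" "x [^] p = \<one>" using Hs(3) by (auto simp: p_torsion_def)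
      show "x \<in> Z"
      proof (cases "x = \<one>")
        case True
        then show ?thesis using subgroup.one_closed[OF Z(1)] by simp
      next
        case False
        have "subgroup (generate G {x}) G" using x(2) by (simp add: generate_is_subgroup)
        moreover have "card (generate G {x}) = p"
          using generate_pow_card[OF x(2)] prime_order_ord[OF p x(2,3) False] by simp
        moreover have "generate G {x} \<subseteq> H" using x(1) Hs(2) by (simp add: generate_subgroup_incl)
        ultimately have "generate G {x} = Z" using uniq[OF _ _ _ Z] by simp
        then show ?thesis using generate.incl[of x "{x}" G] by simp
      qed
    qed
  qed
  show "subgroup (p_torsion p H) G" "card (p_torsion p H) = p" using Z eq by simp_all
  show "z \<otimes> h = h \<otimes> z" if "z \<in> p_torsion p H" "h \<in> H" for z h
    using comm that by (simp only: eq)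
  show "p_torsion p H = A" if "subgroup A G" "A \<subseteq> H" "card A = p" for A
    using uniq[OF Z that] eq by simp
qed

text \<open>The quotient \<phi>(z) / \<phi>(1) is the scalar by which \<open>z\<close> acts. The map
  is the retraction fed to \<open>card_poset_components_retract\<close>.\<close>

definition central_label :: "nat \<Rightarrow> 'a set \<times> ('a \<Rightarrow> complex) \<Rightarrow> 'a set \<times> ('a \<Rightarrow> complex)" where
  "central_label p = (\<lambda>(H, \<phi>). (p_torsion p H, \<lambda>z\<in>p_torsion p H. \<phi> z / \<phi> \<one>))"

definition prime_order_subgroups :: "nat \<Rightarrow> 'a set set" where
  "prime_order_subgroups p = {Z. subgroup Z G \<and> card Z = p}"

lemma card_components_unique:
  assumes p: "Factorial_Ring.prime (p::nat)" and fin: "finite (carrier G)" and P: "sylow_subgroup G p P"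
    and unique: "\<exists>!Q. subgroup Q (G\<lparr>carrier := P\<rparr>) \<and> card Q = p"
  shows "card (poset_components (Gamma G p) (Gamma_le G)) = p * card (prime_order_subgroups p)"
proof -
  let ?L = "Sigma (prime_order_subgroups p) (lin_chars G)"
  note tors = p_torsion_unique[OF p fin P unique]
  note nt = prime_order_nontrivial_p_subgroup[OF p]
  have central: "\<phi> (h \<otimes> z) = (\<phi> z / \<phi> \<one>) * \<phi> h"
    if "(H, \<phi>) \<in> Gamma G p" "z \<in> p_torsion p H" "h \<in> H" for H \<phi> z h
  proof -
    have HS: "H \<in> nontrivial_p_subgroups G p" and \<phi>: "\<phi> \<in> Irr (G\<lparr>carrier := H\<rparr>)"
      using that(1) by (auto simp: Gamma_iff)
    have grp: "group (G\<lparr>carrier := H\<rparr>)" using nontrivial_p_subgroupsD(2)[OF HS] by (rule subgroup_imp_group)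
    have "z \<in> H" using that(2) by (simp add: p_torsion_def)
    then have "\<phi> \<one> * \<phi> (h \<otimes> z) = \<phi> z * \<phi> h"
      using irr_char_central[OF grp \<phi>, of z h] tors(3)[OF HS that(2)] that(3) by simp
    moreover have "\<phi> \<one> \<noteq> 0" using irr_char_one_nonzero[OF grp \<phi>] by simp
    ultimately show ?thesis by (simp add: field_simps)
  qed
  have one: "\<phi> \<one> \<noteq> 0" if "(H, \<phi>) \<in> Gamma G p" for H \<phi>
    using irr_char_one_nonzero[of "G\<lparr>carrier := H\<rparr>" \<phi>] that
      subgroup_imp_group[OF nontrivial_p_subgroupsD(2)[of H p]] by (simp add: Gamma_iff)
  have label: "p_torsion p H \<in> prime_order_subgroups p \<and>
      (\<lambda>z\<in>p_torsion p H. \<phi> z / \<phi> \<one>) \<in> lin_chars G (p_torsion p H)"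
    if H: "(H, \<phi>) \<in> Gamma G p" for H \<phi>
  proof -
    have HS: "H \<in> nontrivial_p_subgroups G p" using H by (simp add: Gamma_iff)
    note Z = tors(1,2)[OF HS]
    have ZH: "p_torsion p H \<subseteq> H" by (auto simp: p_torsion_def)
    \<comment> \<open>For \<open>h\<close> in the torsion subgroup, \<open>central\<close> divided
      by \<phi>(1) is multiplicativity of the label.\<close>
    show ?thesis
      using Z central[OF H] one[OF H] ZH subgroup.one_closed[OF Z(1)] subgroup.m_closed[OF Z(1)]
      by (auto simp: prime_order_subgroups_def lin_chars_def subset_iff)
  qed
  have sub: "?L \<subseteq> Gamma G p"
    using nt lin_char_in_Irr by (auto simp: prime_order_subgroups_def Gamma_iff)
  have "card (poset_components (Gamma G p) (Gamma_le G)) = card ?L"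
  proof (rule card_poset_components_retract[OF sub, of "central_label p"])
    show "central_label p x \<in> ?L" if "x \<in> Gamma G p" for x
      using label that by (cases x) (simp add: central_label_def)
    show "central_label p x = x" if x: "x \<in> ?L" for x
    proof -
      obtain Z \<chi> where Z: "x = (Z, \<chi>)" "subgroup Z G" "card Z = p" "\<chi> \<in> lin_chars G Z"
        using x by (auto simp: prime_order_subgroups_def)
      have "p_torsion p Z = Z" using tors(4)[OF nt[OF Z(2,3)] Z(2) _ Z(3)] by simp
      then show ?thesis
        using Z(1) lin_charsD(1,2)[OF Z(4)] by (simp add: central_label_def extensional_restrict)
    qed
    show "Gamma_le G (central_label p x) x" if x: "x \<in> Gamma G p" for x
    proof -
      obtain H \<phi> where H: "x = (H, \<phi>)" "(H, \<phi>) \<in> Gamma G p" using x by (cases x) auto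
      have "p_torsion p H \<subseteq> H" by (auto simp: p_torsion_def)
      then have "Gamma_le G (p_torsion p H, \<lambda>z\<in>p_torsion p H. \<phi> z / \<phi> \<one>) (H, \<phi>)"
        using label[OF H(2)] one[OF H(2)]
        by (intro lin_char_Gamma_le[OF fin, of _ _ _ "\<phi> \<one>"]) (auto simp: prime_order_subgroups_def)
      then show ?thesis by (simp add: H(1) central_label_def)
    qed
    show "central_label p x = central_label p y"
      if x: "x \<in> Gamma G p" and y: "y \<in> Gamma G p" and le: "Gamma_le G x y" for x y
    proof -
      obtain H \<phi> K \<psi> where H: "x = (H, \<phi>)" "(H, \<phi>) \<in> Gamma G p" and K: "y = (K, \<psi>)" "(K, \<psi>) \<in> Gamma G p"
        using x y by (cases x; cases y) auto
      have HS: "H \<in> nontrivial_p_subgroups G p" and KS: "K \<in> nontrivial_p_subgroups G p"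
        using H(2) K(2) by (auto simp: Gamma_iff)
      have HK: "H \<subseteq> K" and ne: "(\<Sum>h\<in>H. \<phi> h * cnj (\<psi> h)) \<noteq> 0"
        using le by (simp_all add: H(1) K(1) Gamma_le_iff[OF fin nontrivial_p_subgroupsD(2)[OF HS]])
      define Z where "Z = p_torsion p H"
      have ZH: "Z \<subseteq> H" by (auto simp: Z_def p_torsion_def)
      have Zsub: "subgroup Z G" "card Z = p" using tors(1,2)[OF HS] by (auto simp: Z_def)
      have ZK: "p_torsion p K = Z" using tors(4)[OF KS Zsub(1) _ Zsub(2)] ZH HK by auto
      have "\<phi> z / \<phi> \<one> = \<psi> z / \<psi> \<one>" if z: "z \<in> Z" for z
      proof -
        let ?a = "\<phi> z / \<phi> \<one>" and ?b = "\<psi> z / \<psi> \<one>"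
        have zH: "z \<in> H" using z ZH by auto
        note Hsub = nontrivial_p_subgroupsD(2,3)[OF HS]
        have zc: "z \<in> carrier G" using zH Hsub(2) by auto
        \<comment> \<open>Translation by \<open>z\<close> permutes \<open>H\<close> and multiplies
          each summand by the same factor \<open>?a * cnj ?b\<close>; as the sum is non-zero, the
          factor is 1.\<close>
        have "(\<Sum>h\<in>H. \<phi> h * cnj (\<psi> h)) = (\<Sum>h\<in>H. \<phi> (h \<otimes> z) * cnj (\<psi> (h \<otimes> z)))"
          by (rule sum.reindex_bij_witness[of H "\<lambda>h. h \<otimes> z" "\<lambda>h. h \<otimes> inv z"])
            (use Hsub zH zc in \<open>auto simp: subgroup.m_closed subgroup.m_inv_closed m_assoc subset_iff\<close>)
        also have "\<dots> = (\<Sum>h\<in>H. (?a * cnj ?b) * (\<phi> h * cnj (\<psi> h)))"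
        proof (rule sum.cong)
          fix h assume h: "h \<in> H"
          have "\<phi> (h \<otimes> z) = ?a * \<phi> h" using central[OF H(2) _ h] z by (simp add: Z_def)
          moreover have "\<psi> (h \<otimes> z) = ?b * \<psi> h" using central[OF K(2), of z h] z h HK ZK by auto
          ultimately show "\<phi> (h \<otimes> z) * cnj (\<psi> (h \<otimes> z)) = (?a * cnj ?b) * (\<phi> h * cnj (\<psi> h))"
            by (simp add: mult_ac)
        qed simp
        also have "\<dots> = (?a * cnj ?b) * (\<Sum>h\<in>H. \<phi> h * cnj (\<psi> h))" by (rule sum_distrib_left[symmetric])
        finally have ab: "?a * cnj ?b = 1" using ne by (metis mult_cancel_right1)
        \<comment> \<open>\<open>?b\<close> is a value of a linear character of a group of order
          \<open>p\<close>, so it has modulus 1 and \<open>cnj ?b\<close> is its inverse; hence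
          \<open>?a = ?b\<close>.\<close>
        define \<chi> where "\<chi> = (\<lambda>z\<in>Z. \<psi> z / \<psi> \<one>)"
        have \<chi>: "\<chi> \<in> lin_chars G Z" using label[OF K(2)] by (simp add: ZK \<chi>_def)
        have "\<chi> z ^ p = 1"
          using lin_char_nat_pow[OF Zsub(1) \<chi> z, of p] subgroup_pow_card[OF Zsub(1) z] Zsub(2)
            lin_charsD(2)[OF \<chi>] by simp
        then have "cmod ?b = 1"
          using power_eq_1_iff[of "\<chi> z" p] prime_gt_0_nat[OF p] z by (simp add: \<chi>_def)
        then have "?b * cnj ?b = 1" by (metis complex_norm_square of_real_1 one_power2)
        then show ?thesis using ab by (metis mult_cancel_right mult_zero_right zero_neq_one)
      qed
      then have "(\<lambda>z\<in>Z. \<phi> z / \<phi> \<one>) = (\<lambda>z\<in>Z. \<psi> z / \<psi> \<one>)" by (rule restrict_ext)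
      then show ?thesis by (simp add: central_label_def H(1) K(1) ZK Z_def[symmetric])
    qed
  qed
  also have "card ?L = (\<Sum>Z\<in>prime_order_subgroups p. card (lin_chars G Z))"
  proof (rule card_SigmaI)
    have "prime_order_subgroups p \<subseteq> Pow (carrier G)"
      using subgroup.subset by (auto simp: prime_order_subgroups_def)
    then show "finite (prime_order_subgroups p)" using fin finite_subset finite_Pow_iff by metis
    show "\<forall>Z\<in>prime_order_subgroups p. finite (lin_chars G Z)"
      using lin_chars_card(2)[OF p] by (simp add: prime_order_subgroups_def)
  qed
  also have "\<dots> = (\<Sum>Z\<in>prime_order_subgroups p. p)"
    using lin_chars_card(1)[OF p] by (intro sum.cong) (simp_all add: prime_order_subgroups_def)
  finally show ?thesis by simp
qed

text \<open>Every subgroup of order \<open>p\<close> lies in a conjugate of \<open>P\<close>, so it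
  is the corresponding conjugate of \<Omega>_1(P). As \<open>normalizer\<close> is a stabiliser
  under conjugation of subsets, orbit-stabiliser gives the index. Positivity is there to guarantee
  at least two components.\<close>

lemma card_prime_order_subgroups:
  assumes p: "Factorial_Ring.prime (p::nat)" and fin: "finite (carrier G)" and P: "sylow_subgroup G p P"
    and unique: "\<exists>!Q. subgroup Q (G\<lparr>carrier := P\<rparr>) \<and> card Q = p"
  shows "card (prime_order_subgroups p) = card (rcosets (normalizer G (Omega1 G p P)))"
    and "card (prime_order_subgroups p) > 0"
proof -
  have Psub: "subgroup P G" and Pp: "p_subgroup G p P"
    using P by (auto simp: sylow_subgroup_def p_subgroup_def)
  note Pc = subgroup.subset[OF Psub]
  obtain Q where Q: "subgroup Q G" "Q \<subseteq> P" "card Q = p"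
    using unique unfolding subgroup_in_subgroup_iff[OF Psub] by metis
  note Qc = subgroup.subset[OF Q(1)]
  note nt = prime_order_nontrivial_p_subgroup[OF p]
  have "P \<noteq> {\<one>}"
    using Q(2) nontrivial_p_subgroupsD(4)[OF nt[OF Q(1,3)]] subgroup.one_closed[OF Q(1)] by auto
  then have PS: "P \<in> nontrivial_p_subgroups G p" using Pp by (simp add: nontrivial_p_subgroups_def)
  have "p_torsion p P = Q" using p_torsion_unique(4)[OF p fin P unique PS Q] .
  then have "Omega1 G p P = generate G Q" by (simp add: Omega1_def p_torsion_def)
  also have "\<dots> = Q"
    using generate_subgroup_incl[OF subset_refl Q(1)] generate.incl by fast
  finally have Om: "Omega1 G p P = Q" .
  let ?act = "\<lambda>g. \<lambda>H\<in>{H. H \<subseteq> carrier G}. g <# H #> (inv g)"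
  interpret act: group_action G "{H. H \<subseteq> carrier G}" ?act by (rule action_by_conjugation_on_power_set)
  have "orbit G ?act Q = prime_order_subgroups p"
  proof
    show "orbit G ?act Q \<subseteq> prime_order_subgroups p"
      using Q(1,3) Qc subgroup_conj_set card_conj_set
      by (auto simp: orbit_def prime_order_subgroups_def conj_set_eq_cosets)
    show "prime_order_subgroups p \<subseteq> orbit G ?act Q"
    proof
      fix Z assume "Z \<in> prime_order_subgroups p"
      then have Z: "subgroup Z G" "card Z = p" by (auto simp: prime_order_subgroups_def)
      obtain g where g: "g \<in> carrier G" "Z \<subseteq> conj_set G g P"
        by (rule p_subgroup_subset_conj_sylow[OF p fin P nontrivial_p_subgroupsD(1)[OF nt[OF Z]]])
      have "p_subgroup G p (conj_set G g P)" using g(1) Pp by (rule p_subgroup_conj_set)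
      then have "Z = conj_set G g Q"
        using Z(1) g(2) Z(2)
      proof (rule unique_prime_order_in_p_subgroup[OF p fin P unique])
        show "subgroup (conj_set G g Q) G" using g(1) Q(1) by (rule subgroup_conj_set)
        show "conj_set G g Q \<subseteq> conj_set G g P" using Q(2) by (rule conj_set_mono)
        show "card (conj_set G g Q) = p" using card_conj_set[OF g(1) Qc] Q(3) by simp
      qed
      then show "Z \<in> orbit G ?act Q" using g(1) Qc by (auto simp: orbit_def conj_set_eq_cosets)
    qed
  qed
  then show "card (prime_order_subgroups p) = card (rcosets (normalizer G (Omega1 G p P)))"
    using bij_betw_same_card[OF act.orbit_stab_fun_is_bij[of Q]] Qc by (simp add: Om normalizer_def)
  have "prime_order_subgroups p \<subseteq> Pow (carrier G)"
    using subgroup.subset by (auto simp: prime_order_subgroups_def)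
  then have "finite (prime_order_subgroups p)" using fin finite_subset finite_Pow_iff by metis
  moreover have "Q \<in> prime_order_subgroups p" using Q by (simp add: prime_order_subgroups_def)
  ultimately show "card (prime_order_subgroups p) > 0" by (auto simp: card_gt_0_iff)
qed

end

lemma poset_disconnectedI_card:
  assumes "card (poset_components S r) \<ge> 2"
  shows "poset_disconnected S r"
proof (rule ccontr)
  assume "\<not> poset_disconnected S r"
  then have "\<forall>C\<in>poset_components S r. \<forall>D\<in>poset_components S r. C = D"
    by (auto simp: poset_disconnected_def)
  \<comment> \<open>An infinite set has \<open>card\<close> 0, so the bound yields
    finiteness.\<close>
  moreover have "finite (poset_components S r)" using assms by (intro card_ge_0_finite) simp
  ultimately have "card (poset_components S r) \<le> Suc 0" by (simp add: card_le_Suc0_iff_eq)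
  then show False using assms by simp
qed

theorem theorem2:
  fixes G :: "('a, 'b) monoid_scheme" and p :: nat and P :: "'a set"
  assumes "group G" and "finite (carrier G)" and "Factorial_Ring.prime p" and "sylow_subgroup G p P"
  shows "(poset_disconnected (Gamma G p) (Gamma_le G) \<longleftrightarrow>
            (\<exists>!Q. subgroup Q (G\<lparr>carrier := P\<rparr>) \<and> card Q = p) \<or>
            (\<exists>H. strongly_embedded G p H))
       \<and> ((\<exists>!Q. subgroup Q (G\<lparr>carrier := P\<rparr>) \<and> card Q = p) \<longrightarrow>
            card (poset_components (Gamma G p) (Gamma_le G)) =
              p * card (rcosets\<^bsub>G\<^esub> (normalizer G (Omega1 G p P))))"
proof -
  interpret group G by fact
  let ?unique = "\<exists>!Q. subgroup Q (G\<lparr>carrier := P\<rparr>) \<and> card Q = p"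
  have card: "card (poset_components (Gamma G p) (Gamma_le G)) =
      p * card (rcosets\<^bsub>G\<^esub> (normalizer G (Omega1 G p P)))"
    and disc: "poset_disconnected (Gamma G p) (Gamma_le G)" if ?unique
  proof -
    note eq = card_components_unique[OF assms(3,2,4) that]
      and orb = card_prime_order_subgroups[OF assms(3,2,4) that]
    show "card (poset_components (Gamma G p) (Gamma_le G)) =
      p * card (rcosets\<^bsub>G\<^esub> (normalizer G (Omega1 G p P)))"
      using eq orb(1) by simp
    \<comment> \<open>The linear characters of one subgroup of order \<open>p\<close> already label
      \<open>p \<ge> 2\<close> components.\<close>
    have "2 * 1 \<le> p * card (prime_order_subgroups p)"
      using orb(2) prime_ge_2_nat[OF assms(3)] by (intro mult_le_mono) simp_all
    then show "poset_disconnected (Gamma G p) (Gamma_le G)"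
      using eq by (intro poset_disconnectedI_card) simp
  qed
  have "poset_disconnected (Gamma G p) (Gamma_le G) \<longleftrightarrow> ?unique \<or> (\<exists>H. strongly_embedded G p H)"
    using disc strongly_embedded_Gamma_disconnected[OF assms(3,2)]
      Gamma_not_disconnected[OF assms(3,2,4)] by blast
  then show ?thesis using card by blast
qed

end
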